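(* Assume that $\mathcal C$ satisfies the hypotheses (H1), (H2), (H3) listed in the context. Then for any initial datum $U_0\in\mathcal H$ and any $f\in L^2(0,\tau;\mathcal U)$ there exists a unique (mild) solution $U\in C([0,+\infty),\mathcal H)$ of $$U_t(t)=\mathcal A U(t)+k\,\mathcal C\mathcal C^*U(t-\tau)\ \text{ in }(0,+\infty),\qquad U(0)=U_0,\qquad \mathcal C^*U(t-\tau)=f(t)\ \ \forall t\in(0,\tau).$$
   Context: $\mathcal H$ is a Hilbert space; $\mathcal A$ generates a $C_0$-semigroup $(S(t))_{t\ge0}$ on $\mathcal H$ with $\|S(t)\|_{\mathcal L(\mathcal H)}\le Me^{-\omega t}$ for all $t\ge0$ ($M,\omega>0$ fixed). $\tau>0$ is a fixed delay and $k\in\mathbb R$. $\mathcal U$ is a complex Hilbert space identified with its dual. $\mathcal H_{-1}=D(\mathcal A^* )'$ is the dual of $D(\mathcal A^* )$ with respect to the pivot space $\mathcal H$; $S(t)$ extends to a $C_0$-semigroup on $\mathcal H_{-1}$, denoted by the same symbol. $\mathcal C\in\mathcal L(\mathcal U,\mathcal H_{-1})$ and $\mathcal C^*\in\mathcal L(D(\mathcal A),\mathcal U)$; precisely, $\mathcal C^*$ is a linear operator into $\mathcal U$ whose domain is a subspace of $\mathcal H$ containing $D(\mathcal A)$ and $D(\mathcal A^* )$, bounded on each of these for the graph norm, with $\langle\mathcal C u,z\rangle=\langle u,\mathcal C^*z\rangle_{\mathcal U}$ for $u\in\mathcal U$, $z\in D(\mathcal A^* )$. For $t\ge0$ and $v\in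 L^2(0,\tau;\mathcal U)$ (used for $t\in[0,\tau]$), $$\Phi_tv=\int_0^tS(t-\sigma)\,\mathcal C v(\sigma)\,d\sigma\in\mathcal H_{-1}.$$ Hypotheses: (H1) for all $v\in L^2(0,\tau;\mathcal U)$, $t\mapsto\Phi_tv$ belongs to $C([0,\tau],\mathcal H)$, and there is $C_1>0$ with $\|\Phi_\tau v\|_{\mathcal H}\le C_1\|v\|_{L^2(0,\tau;\mathcal U)}$ for all $v$; (H2) for all $v\in L^2(0,\tau;\mathcal U)$, $t\mapsto\mathcal C^*\Phi_tv$ belongs to $L^2(0,\tau;\mathcal U)$, and there is $C_3>0$ with $\|\mathcal C^*\Phi_{\cdot}v\|_{L^2(0,\tau;\mathcal U)}\le C_3\|v\|_{L^2(0,\tau;\mathcal U)}$ for all $v$; (H3) for all $z_0\in\mathcal H$, $t\mapsto\mathcal C^*S(t)z_0$ belongs to $L^2(0,\tau;\mathcal U)$, and there is $C_2>0$ with $\|\mathcal C^*S(\cdot)z_0\|_{L^2(0,\tau;\mathcal U)}\le C_2\|z_0\|_{\mathcal H}$ for all $z_0$. (In (H2), (H3) it is understood that the argument of $\mathcal C^*$ lies in its domain for a.e. $t$.) A mild solution is $U\in C([0,+\infty),\mathcal H)$ such that $\mathcal C^*U$ is defined a.e. and lies in $L^2_{loc}([0,+\infty);\mathcal U)$, and $$U(t)=S(t)U_0+k\int_0^tS(t-s)\,\mathcal C v(s)\,ds,\quad t\ge0,$$ with $v(s)=f(s)$ for $s\in(0,\tau)$ and $v(s)=\mathcal C^*U(s-\tau)$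 for $s>\tau$. *)

theory Defs
  imports "HOL-Analysis.Analysis"
begin

section \<open>Complex Hilbert spaces\<close>

class scaleC =
  fixes scaleC :: "complex \<Rightarrow> 'a \<Rightarrow> 'a"  (infixr \<open>*\<^sub>C\<close> 75)

class complex_normed_vector = real_normed_vector + scaleC +
  assumes scaleC_add_right: "c *\<^sub>C (x + y) = c *\<^sub>C x + c *\<^sub>C y"
    and scaleC_add_left: "(c + d) *\<^sub>C x = c *\<^sub>C x + d *\<^sub>C x"
    and scaleC_scaleC: "c *\<^sub>C d *\<^sub>C x = (c * d) *\<^sub>C x"
    and scaleC_of_real: "complex_of_real r *\<^sub>C x = r *\<^sub>R x"
    and norm_scaleC: "norm (c *\<^sub>C x) = cmod c * norm x"

text \<open>
  The inner product is linear in its first and antilinear in its second argument. Hermitian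
  symmetry makes \<open>cinner x x\<close> real; it equals the squared norm, and is hence positive definite,
  because \<open>inner\<close> is required to be the real part of \<open>cinner\<close>. A complex Hilbert space is a type of
  sort \<open>{complex_inner, banach}\<close>.
\<close>

class complex_inner = complex_normed_vector + real_inner +
  fixes cinner :: "'a \<Rightarrow> 'a \<Rightarrow> complex"
  assumes cinner_commute: "cinner x y = cnj (cinner y x)"
    and cinner_add_left: "cinner (x + y) z = cinner x z + cinner y z"
    and cinner_scaleC_left: "cinner (c *\<^sub>C x) y = c * cinner x y"
    and inner_eq_Re_cinner: "inner x y = Re (cinner x y)"

instantiation complex :: complex_inner
begin

definition scaleC_complex :: "complex \<Rightarrow> complex \<Rightarrow> complex" where
  "scaleC_complex c x = c * x"

definition cinner_complex :: "complex \<Rightarrow> complex \<Rightarrow> complex" where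
  "cinner_complex x y = x * cnj y"

instance
  by standard
    (auto simp: scaleC_complex_def cinner_complex_def norm_mult scaleR_conv_of_real
      inner_complex_def algebra_simps)

end

definition csubspace :: "'a::complex_normed_vector set \<Rightarrow> bool" where
  "csubspace V \<longleftrightarrow> 0 \<in> V \<and> (\<forall>x\<in>V. \<forall>y\<in>V. x + y \<in> V) \<and> (\<forall>c. \<forall>x\<in>V. c *\<^sub>C x \<in> V)"

definition clinear_on ::
  "'a::complex_normed_vector set \<Rightarrow> ('a \<Rightarrow> 'b::complex_normed_vector) \<Rightarrow> bool" where
  "clinear_on V f \<longleftrightarrow>
     (\<forall>x\<in>V. \<forall>y\<in>V. f (x + y) = f x + f y) \<and> (\<forall>c. \<forall>x\<in>V. f (c *\<^sub>C x) = c *\<^sub>C f x)"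

definition bounded_clinear ::
  "('a::complex_normed_vector \<Rightarrow> 'b::complex_normed_vector) \<Rightarrow> bool" where
  "bounded_clinear f \<longleftrightarrow> bounded_linear f \<and> (\<forall>c x. f (c *\<^sub>C x) = c *\<^sub>C f x)"


section \<open>Semigroups, generators and adjoints\<close>

definition C0_semigroup :: "(real \<Rightarrow> 'a \<Rightarrow> 'a::complex_normed_vector) \<Rightarrow> bool" where
  "C0_semigroup S \<longleftrightarrow>
     (\<forall>t\<ge>0. bounded_clinear (S t)) \<and>
     (\<forall>x. S 0 x = x) \<and>
     (\<forall>s\<ge>0. \<forall>t\<ge>0. \<forall>x. S (s + t) x = S s (S t x)) \<and>
     (\<forall>x. ((\<lambda>t. S t x) \<longlongrightarrow> x) (at_right 0))"

text \<open>
  An unbounded operator is given by its domain \<open>D\<close> and a total function \<open>A\<close>, whose values outside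
  \<open>D\<close> are irrelevant.
\<close>

definition generates ::
  "'a::complex_normed_vector set \<Rightarrow> ('a \<Rightarrow> 'a) \<Rightarrow> (real \<Rightarrow> 'a \<Rightarrow> 'a) \<Rightarrow> bool" where
  "generates D A S \<longleftrightarrow>
     D = {x. \<exists>y. ((\<lambda>h. (S h x - x) /\<^sub>R h) \<longlongrightarrow> y) (at_right 0)} \<and>
     (\<forall>x\<in>D. ((\<lambda>h. (S h x - x) /\<^sub>R h) \<longlongrightarrow> A x) (at_right 0))"

definition adj_dom :: "'a::complex_inner set \<Rightarrow> ('a \<Rightarrow> 'a) \<Rightarrow> 'a set" where
  "adj_dom D A = {z. \<exists>w. \<forall>x\<in>D. cinner (A x) z = cinner x w}"

definition adj :: "'a::complex_inner set \<Rightarrow> ('a \<Rightarrow> 'a) \<Rightarrow> 'a \<Rightarrow> 'a" where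
  "adj D A z = (THE w. \<forall>x\<in>D. cinner (A x) z = cinner x w)"

definition graph_norm :: "('a::real_normed_vector \<Rightarrow> 'a) \<Rightarrow> 'a \<Rightarrow> real" where
  "graph_norm A x = sqrt ((norm x)\<^sup>2 + (norm (A x))\<^sup>2)"

definition graph_bounded_on ::
  "'a::real_normed_vector set \<Rightarrow> ('a \<Rightarrow> 'a) \<Rightarrow> ('a \<Rightarrow> 'b::real_normed_vector) \<Rightarrow> bool" where
  "graph_bounded_on D A T \<longleftrightarrow> (\<exists>K. \<forall>x\<in>D. norm (T x) \<le> K * graph_norm A x)"


section \<open>The extrapolation space\<close>

text \<open>
  The dual is taken to consist of antilinear functionals: this is what makes the embedding
  \<open>x \<mapsto> cinner x\<close> of the pivot space linear.
\<close>

definition bounded_antilinear_on ::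
  "'a::complex_normed_vector set \<Rightarrow> ('a \<Rightarrow> real) \<Rightarrow> ('a \<Rightarrow> complex) \<Rightarrow> bool" where
  "bounded_antilinear_on V N l \<longleftrightarrow>
     (\<forall>x\<in>V. \<forall>y\<in>V. l (x + y) = l x + l y) \<and>
     (\<forall>c. \<forall>x\<in>V. l (c *\<^sub>C x) = cnj c * l x) \<and>
     (\<exists>K. \<forall>x\<in>V. cmod (l x) \<le> K * N x)"

text \<open>
  The space \<open>D(A\<^sup>*)'\<close> depends on the operator \<open>A\<close> and so cannot be a type constructed from that
  of the Hilbert space. It is therefore an arbitrary type \<open>'m\<close> with a duality pairing \<open>dual\<close> for which
  \<open>\<phi> \<mapsto> dual \<phi>\<close> is an isometric isomorphism of \<open>'m\<close> onto the bounded antilinear functionals on the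
  normed space \<open>(V, N)\<close>; injectivity follows from the formula for the norm.
\<close>

definition realizes_dual ::
  "'a::complex_normed_vector set \<Rightarrow> ('a \<Rightarrow> real) \<Rightarrow>
    ('m::complex_normed_vector \<Rightarrow> 'a \<Rightarrow> complex) \<Rightarrow> bool" where
  "realizes_dual V N dual \<longleftrightarrow>
     (\<forall>\<phi>. bounded_antilinear_on V N (dual \<phi>)) \<and>
     (\<forall>\<phi> \<psi>. \<forall>z\<in>V. dual (\<phi> + \<psi>) z = dual \<phi> z + dual \<psi> z) \<and>
     (\<forall>c \<phi>. \<forall>z\<in>V. dual (c *\<^sub>C \<phi>) z = c * dual \<phi> z) \<and>
     (\<forall>\<phi>. norm \<phi> = (SUP z\<in>{z\<in>V. N z \<le> 1}. cmod (dual \<phi> z))) \<and>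
     (\<forall>l. bounded_antilinear_on V N l \<longrightarrow> (\<exists>\<phi>. \<forall>z\<in>V. dual \<phi> z = l z))"

text \<open>
  \<open>dual\<close> realizes \<open>D(A\<^sup>*)'\<close>, \<open>\<iota>\<close> is the embedding of the pivot space into it, and \<open>S1\<close> is the
  extension of the semigroup \<open>S\<close>.
\<close>

definition extrapolation_space ::
  "'h::complex_inner set \<Rightarrow> ('h \<Rightarrow> 'h) \<Rightarrow> (real \<Rightarrow> 'h \<Rightarrow> 'h) \<Rightarrow>
    ('m::complex_normed_vector \<Rightarrow> 'h \<Rightarrow> complex) \<Rightarrow> ('h \<Rightarrow> 'm) \<Rightarrow> (real \<Rightarrow> 'm \<Rightarrow> 'm) \<Rightarrow> bool" where
  "extrapolation_space D A S dual \<iota> S1 \<longleftrightarrow>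
     realizes_dual (adj_dom D A) (graph_norm (adj D A)) dual \<and>
     (\<forall>x. \<forall>z\<in>adj_dom D A. dual (\<iota> x) z = cinner x z) \<and>
     C0_semigroup S1 \<and>
     (\<forall>t\<ge>0. \<forall>x. S1 t (\<iota> x) = \<iota> (S t x))"


section \<open>Bochner integration without separability\<close>

text \<open>
  The library's Bochner integral needs \<open>second_countable_topology\<close>, which would restrict the results to
  separable Hilbert spaces. The following is the same definition with Borel measurability replaced by
  strong measurability, that is, by being an almost everywhere limit of simple functions.
\<close>

definition strongly_measurable :: "'a measure \<Rightarrow> ('a \<Rightarrow> 'b::topological_space) \<Rightarrow> bool" where
  "strongly_measurable M f \<longleftrightarrow>
     (\<exists>s. (\<forall>i::nat. simple_function M (s i)) \<and> (AE x in M. (\<lambda>i. s i x) \<longlonglongrightarrow> f x))"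

definition has_strong_integral ::
  "'a measure \<Rightarrow> ('a \<Rightarrow> 'b::real_normed_vector) \<Rightarrow> 'b \<Rightarrow> bool" where
  "has_strong_integral M f y \<longleftrightarrow>
     strongly_measurable M f \<and>
     (\<exists>s. (\<forall>i::nat. Bochner_Integration.simple_bochner_integrable M (s i)) \<and>
          (\<lambda>i. \<integral>\<^sup>+x. norm (f x - s i x) \<partial>M) \<longlonglongrightarrow> 0 \<and>
          (\<lambda>i. Bochner_Integration.simple_bochner_integral M (s i)) \<longlonglongrightarrow> y)"

definition strong_integral :: "'a measure \<Rightarrow> ('a \<Rightarrow> 'b::real_normed_vector) \<Rightarrow> 'b" where
  "strong_integral M f =
     (if \<exists>y. has_strong_integral M f y then THE y. has_strong_integral M f y else 0)"

definition in_L2 :: "real set \<Rightarrow> (real \<Rightarrow> 'b::real_normed_vector) \<Rightarrow> bool" where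
  "in_L2 I f \<longleftrightarrow>
     strongly_measurable (lebesgue_on I) f \<and> (\<integral>\<^sup>+t. (norm (f t))\<^sup>2 \<partial>lebesgue_on I) < \<infinity>"

definition norm_L2 :: "real set \<Rightarrow> (real \<Rightarrow> 'b::real_normed_vector) \<Rightarrow> real" where
  "norm_L2 I f = sqrt (\<integral>t. (norm (f t))\<^sup>2 \<partial>lebesgue_on I)"


section \<open>The delayed feedback system\<close>

definition Phi ::
  "(real \<Rightarrow> 'm \<Rightarrow> 'm::complex_normed_vector) \<Rightarrow> ('u \<Rightarrow> 'm) \<Rightarrow> real \<Rightarrow> (real \<Rightarrow> 'u) \<Rightarrow> 'm" where
  "Phi S1 C t v = strong_integral (lebesgue_on {0<..<t}) (\<lambda>\<sigma>. S1 (t - \<sigma>) (C (v \<sigma>)))"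

text \<open>
  \<open>Cs\<close> with domain \<open>DC\<close> stands for the operator \<open>C\<^sup>*\<close>.
\<close>

definition observation_operator ::
  "'h::complex_inner set \<Rightarrow> ('h \<Rightarrow> 'h) \<Rightarrow> ('m \<Rightarrow> 'h \<Rightarrow> complex) \<Rightarrow> ('u::complex_inner \<Rightarrow> 'm) \<Rightarrow>
    'h set \<Rightarrow> ('h \<Rightarrow> 'u) \<Rightarrow> bool" where
  "observation_operator D A dual C DC Cs \<longleftrightarrow>
     csubspace DC \<and> clinear_on DC Cs \<and>
     D \<subseteq> DC \<and> adj_dom D A \<subseteq> DC \<and>
     graph_bounded_on D A Cs \<and> graph_bounded_on (adj_dom D A) (adj D A) Cs \<and>
     (\<forall>u. \<forall>z\<in>adj_dom D A. dual (C u) z = cinner u (Cs z))"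

text \<open>
  In the hypotheses, an element of \<open>'m\<close> that lies in the pivot space is read as an element of \<open>'h\<close>
  by means of \<open>inv \<iota>\<close>.
\<close>

definition hyp_H1 ::
  "('h::real_normed_vector \<Rightarrow> 'm::complex_normed_vector) \<Rightarrow> (real \<Rightarrow> 'm \<Rightarrow> 'm) \<Rightarrow>
    ('u::real_normed_vector \<Rightarrow> 'm) \<Rightarrow> real \<Rightarrow> bool" where
  "hyp_H1 \<iota> S1 C \<tau> \<longleftrightarrow>
     (\<forall>v. in_L2 {0<..<\<tau>} v \<longrightarrow>
        (\<forall>t\<in>{0..\<tau>}. Phi S1 C t v \<in> range \<iota>) \<and>
        continuous_on {0..\<tau>} (\<lambda>t. inv \<iota> (Phi S1 C t v))) \<and>
     (\<exists>C1>0. \<forall>v. in_L2 {0<..<\<tau>} v \<longrightarrow>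
        norm (inv \<iota> (Phi S1 C \<tau> v)) \<le> C1 * norm_L2 {0<..<\<tau>} v)"

definition hyp_H2 ::
  "('h \<Rightarrow> 'm::complex_normed_vector) \<Rightarrow> (real \<Rightarrow> 'm \<Rightarrow> 'm) \<Rightarrow>
    ('u::real_normed_vector \<Rightarrow> 'm) \<Rightarrow> 'h set \<Rightarrow> ('h \<Rightarrow> 'u) \<Rightarrow> real \<Rightarrow> bool" where
  "hyp_H2 \<iota> S1 C DC Cs \<tau> \<longleftrightarrow>
     (\<forall>v. in_L2 {0<..<\<tau>} v \<longrightarrow>
        (AE t in lebesgue_on {0<..<\<tau>}. Phi S1 C t v \<in> \<iota> ` DC) \<and>
        in_L2 {0<..<\<tau>} (\<lambda>t. Cs (inv \<iota> (Phi S1 C t v)))) \<and>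
     (\<exists>C3>0. \<forall>v. in_L2 {0<..<\<tau>} v \<longrightarrow>
        norm_L2 {0<..<\<tau>} (\<lambda>t. Cs (inv \<iota> (Phi S1 C t v))) \<le> C3 * norm_L2 {0<..<\<tau>} v)"

definition hyp_H3 ::
  "(real \<Rightarrow> 'h \<Rightarrow> 'h::real_normed_vector) \<Rightarrow> 'h set \<Rightarrow> ('h \<Rightarrow> 'u::real_normed_vector) \<Rightarrow>
    real \<Rightarrow> bool" where
  "hyp_H3 S DC Cs \<tau> \<longleftrightarrow>
     (\<forall>z. (AE t in lebesgue_on {0<..<\<tau>}. S t z \<in> DC) \<and>
          in_L2 {0<..<\<tau>} (\<lambda>t. Cs (S t z))) \<and>
     (\<exists>C2>0. \<forall>z. norm_L2 {0<..<\<tau>} (\<lambda>t. Cs (S t z)) \<le> C2 * norm z)"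

definition mild_solution ::
  "(real \<Rightarrow> 'h \<Rightarrow> 'h) \<Rightarrow> ('h::real_normed_vector \<Rightarrow> 'm::complex_normed_vector) \<Rightarrow>
    (real \<Rightarrow> 'm \<Rightarrow> 'm) \<Rightarrow> ('u::real_normed_vector \<Rightarrow> 'm) \<Rightarrow> 'h set \<Rightarrow> ('h \<Rightarrow> 'u) \<Rightarrow>
    real \<Rightarrow> real \<Rightarrow> 'h \<Rightarrow> (real \<Rightarrow> 'u) \<Rightarrow> (real \<Rightarrow> 'h) \<Rightarrow> bool" where
  "mild_solution S \<iota> S1 C DC Cs k \<tau> U0 f U \<longleftrightarrow>
     continuous_on {0..} U \<and>
     (AE t in lebesgue_on {0..}. U t \<in> DC) \<and>
     (\<forall>T>0. in_L2 {0<..<T} (\<lambda>t. Cs (U t))) \<and>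
     (\<forall>t\<ge>0. \<iota> (U t) =
        \<iota> (S t U0) + k *\<^sub>R Phi S1 C t (\<lambda>s. if s < \<tau> then f s else Cs (U (s - \<tau>))))"

end

theory Submission
  imports Defs
begin

text \<open>
  The delay makes the feedback explicit. On the interval \<open>(0, \<tau>)\<close> the delayed observation is the given
  function \<open>f\<close>, so the integral equation simply defines \<open>U\<close> there as the sum of the free motion
  \<open>S t U0\<close> and of \<open>k\<close> times the controlled motion \<open>\<Phi>\<^sub>t f\<close>. By H1 this is a continuous function with
  values in the pivot space, and by H2 and H3 its observation is again square-integrable. That observation is
  the delayed input on the next interval, where the same construction starts again from the state reached
  (\<open>piece\<close>, \<open>stage\<close>). Uniqueness follows in the same way: a solution up to time \<open>n \<tau>\<close> determines the
  right-hand side of the equation up to time \<open>(n+1) \<tau>\<close> (\<open>mild_solution_unique\<close>).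

  That the pieces solve one integral equation over the whole half-line rests on the formula
  \<open>\<Phi>\<^bsub>a + b\<^esub> v = S b (\<Phi>\<^sub>a v) + \<Phi>\<^sub>b (\<lambda>s. v (s + a))\<close> (\<open>Phi_append\<close>). It is proved by pairing with elements of
  the domain of the adjoint generator: these pairings are bounded functionals that separate the points of the
  extrapolation space (\<open>extrapolation_functionals\<close>), and they turn strong integrals into scalar
  Lebesgue integrals (\<open>has_bochner_integral_functional\<close>). For this the integrals must exist, which
  is the content of \<open>has_strong_integral_Phi\<close>; the bound it needs on the extended semigroup comes from
  the uniform boundedness principle (\<open>C0_semigroup_locally_bounded\<close>).

  An equation in the extrapolation space determines the state only if the pivot space embeds injectively,
  that is, if the domain of the adjoint generator is dense (\<open>adj_dom_dense\<close>). Elements of that domain are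
  produced by the Hilbert space adjoints of the averages \<open>x \<mapsto> \<integral>\<^sub>0\<^sup>h S t x dt\<close> over orbits.
\<close>

section \<open>Strong measurability and the strong integral\<close>

text \<open>Strong measurability ignores null sets. On a complete measure space this does no harm, as null sets
  and all their subsets are measurable, and norms or scalar images of a strongly measurable function
  are measurable in the ordinary sense.\<close>

lemma complete_measure_lebesgue_on:
  assumes "I \<in> sets lebesgue"
  shows "complete_measure (lebesgue_on I)"
proof
  fix A B assume "B \<subseteq> A" "A \<in> null_sets (lebesgue_on I)"
  then show "B \<in> sets (lebesgue_on I)"
    using assms null_sets_completion_subset[of B A lborel]
    by (auto simp: null_sets_restrict_space sets_restrict_space_iff)
qed

lemma strongly_measurable_borel:
  fixes f :: "'a \<Rightarrow> 'b::real_normed_vector"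
  assumes "complete_measure M" "strongly_measurable M f"
  shows "f \<in> borel_measurable M"
proof -
  interpret complete_measure M by fact
  obtain s where s: "\<And>i::nat. simple_function M (s i)"
    and lim: "AE x in M. (\<lambda>i. s i x) \<longlonglongrightarrow> f x"
    using assms(2) unfolding strongly_measurable_def by blast
  from lim obtain N where N: "N \<in> null_sets M" "{x \<in> space M. \<not> (\<lambda>i. s i x) \<longlonglongrightarrow> f x} \<subseteq> N"
    unfolding eventually_ae_filter by blast
  define g where "g x = (if x \<in> N then 0 else f x)" for x
  have [measurable]: "s i \<in> borel_measurable M" for i
    using s by (rule borel_measurable_simple_function)
  have [measurable]: "N \<in> sets M" using N by auto
  have g: "g \<in> borel_measurable M"
    by (rule borel_measurable_LIMSEQ_metric[where f = "\<lambda>i x. if x \<in> N then 0 else s i x"])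
      (use N in \<open>auto simp: g_def\<close>)
  have eq: "AE x in M. g x = f x"
    using AE_not_in[OF N(1)] by eventually_elim (simp add: g_def)
  show ?thesis
  proof (rule measurableI)
    fix A :: "'b set" assume A: "A \<in> sets borel"
    show "f -` A \<inter> space M \<in> sets M"
      by (rule in_sets_AE[OF _ measurable_sets[OF g A]]) (use eq in \<open>auto elim: eventually_mono\<close>)
  qed simp
qed

lemma strongly_measurable_compose:
  assumes "strongly_measurable M f" "\<And>x. isCont g x"
  shows "strongly_measurable M (\<lambda>x. g (f x))"
proof -
  obtain s where s: "\<And>i::nat. simple_function M (s i)"
    and lim: "AE x in M. (\<lambda>i. s i x) \<longlonglongrightarrow> f x"
    using assms(1) unfolding strongly_measurable_def by blast
  have "AE x in M. (\<lambda>i. g (s i x)) \<longlonglongrightarrow> g (f x)"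
    using lim by eventually_elim (rule isCont_tendsto_compose[OF assms(2)])
  moreover have "simple_function M (\<lambda>x. g (s i x))" for i
    using simple_function_compose[OF s] by (simp add: comp_def)
  ultimately show ?thesis
    unfolding strongly_measurable_def by (intro exI[of _ "\<lambda>i x. g (s i x)"]) blast
qed

lemma strongly_measurable_add:
  fixes f g :: "'a \<Rightarrow> 'b::real_normed_vector"
  assumes "strongly_measurable M f" "strongly_measurable M g"
  shows "strongly_measurable M (\<lambda>x. f x + g x)"
proof -
  obtain s where s: "\<And>i::nat. simple_function M (s i)"
    and lim: "AE x in M. (\<lambda>i. s i x) \<longlonglongrightarrow> f x"
    using assms(1) unfolding strongly_measurable_def by blast
  obtain s' where s': "\<And>i::nat. simple_function M (s' i)"
    and lim': "AE x in M. (\<lambda>i. s' i x) \<longlonglongrightarrow> g x"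
    using assms(2) unfolding strongly_measurable_def by blast
  have "AE x in M. (\<lambda>i. s i x + s' i x) \<longlonglongrightarrow> f x + g x"
    using lim lim' by eventually_elim (rule tendsto_add)
  moreover have "simple_function M (\<lambda>x. s i x + s' i x)" for i
    using simple_function_compose2[OF s s'] .
  ultimately show ?thesis
    unfolding strongly_measurable_def by (intro exI[of _ "\<lambda>i x. s i x + s' i x"]) blast
qed

lemma strongly_measurable_cong_AE:
  assumes "strongly_measurable M f" "AE x in M. f x = g x"
  shows "strongly_measurable M g"
proof -
  obtain s where s: "\<And>i::nat. simple_function M (s i)"
    and lim: "AE x in M. (\<lambda>i. s i x) \<longlonglongrightarrow> f x"
    using assms(1) unfolding strongly_measurable_def by blast
  have "AE x in M. (\<lambda>i. s i x) \<longlonglongrightarrow> g x"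
    using lim assms(2) by eventually_elim simp
  then show ?thesis using s unfolding strongly_measurable_def by blast
qed

text \<open>Extension by zero moves a function on an interval to the whole line, where translates and sums of
  functions living on different intervals make sense.\<close>

lemma strongly_measurable_restrict_space:
  fixes f :: "'a \<Rightarrow> 'b::real_normed_vector"
  assumes "I \<in> sets M"
  shows "strongly_measurable (restrict_space M I) f \<longleftrightarrow>
    strongly_measurable M (\<lambda>x. indicator I x *\<^sub>R f x)"
proof -
  have I: "I \<inter> space M \<in> sets M" using assms by auto
  show ?thesis
  proof
    assume "strongly_measurable (restrict_space M I) f"
    then obtain s where s: "\<And>i::nat. simple_function (restrict_space M I) (s i)"
      and lim: "AE x in restrict_space M I. (\<lambda>i. s i x) \<longlonglongrightarrow> f x"
      unfolding strongly_measurable_def by blast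
    have "AE x in M. (\<lambda>i. indicator I x *\<^sub>R s i x) \<longlonglongrightarrow> indicator I x *\<^sub>R f x"
      using lim unfolding AE_restrict_space_iff[OF I]
      by eventually_elim (auto split: split_indicator)
    then show "strongly_measurable M (\<lambda>x. indicator I x *\<^sub>R f x)"
      using s unfolding strongly_measurable_def simple_function_restrict_space[OF I]
      by (intro exI[of _ "\<lambda>i x. indicator I x *\<^sub>R s i x"]) blast
  next
    assume "strongly_measurable M (\<lambda>x. indicator I x *\<^sub>R f x)"
    then obtain s where s: "\<And>i::nat. simple_function M (s i)"
      and lim: "AE x in M. (\<lambda>i. s i x) \<longlonglongrightarrow> indicator I x *\<^sub>R f x"
      unfolding strongly_measurable_def by blast
    have "simple_function (restrict_space M I) (s i)" for i
      unfolding simple_function_restrict_space[OF I] using assms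
      by (intro simple_function_compose2[OF _ s, of _ "\<lambda>a b. a *\<^sub>R b"] simple_function_indicator)
    moreover have "AE x in restrict_space M I. (\<lambda>i. s i x) \<longlonglongrightarrow> f x"
      unfolding AE_restrict_space_iff[OF I] using lim by eventually_elim auto
    ultimately show "strongly_measurable (restrict_space M I) f"
      unfolding strongly_measurable_def by blast
  qed
qed

lemma measurable_lebesgue_shift: "(\<lambda>x::real. x + a) \<in> lebesgue \<rightarrow>\<^sub>M lebesgue"
  using lebesgue_affine_measurable[where c = "\<lambda>_::real. 1" and t = a] by (simp add: add.commute)

lemma AE_lebesgue_shift:
  fixes a :: real
  assumes "AE x in lebesgue. P x"
  shows "AE x in lebesgue. P (x + a)"
proof -
  have "lebesgue = distr lebesgue lebesgue (\<lambda>x::real. x + a)"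
    using lebesgue_real_affine[of 1 a] by (simp add: add.commute density_1)
  from arg_cong[where f = "\<lambda>M. AE x in M. P x", OF this]
  have "AE x in distr lebesgue lebesgue (\<lambda>x::real. x + a). P x"
    using assms by (rule iffD1)
  then show ?thesis
    by (rule AE_distrD[OF measurable_lebesgue_shift])
qed

lemma strongly_measurable_shift:
  fixes f :: "real \<Rightarrow> 'b::real_normed_vector"
  assumes "strongly_measurable lebesgue f"
  shows "strongly_measurable lebesgue (\<lambda>x. f (x + a))"
proof -
  obtain s where s: "\<And>i::nat. simple_function lebesgue (s i)"
    and lim: "AE x in lebesgue. (\<lambda>i. s i x) \<longlonglongrightarrow> f x"
    using assms unfolding strongly_measurable_def by blast
  have "simple_function lebesgue (\<lambda>x. s i (x + a))" for i
    using simple_function_comp[OF measurable_lebesgue_shift s[of i]] by (simp add: comp_def)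
  then show ?thesis
    using AE_lebesgue_shift[OF lim, of a] unfolding strongly_measurable_def
    by (intro exI[of _ "\<lambda>i x. s i (x + a)"]) blast
qed

text \<open>Applied to two approximating sequences of the same function this estimate makes the integral unique;
  applied to two members of one sequence it makes their integrals a Cauchy sequence.\<close>

lemma simple_bochner_integral_dist:
  fixes f :: "'a \<Rightarrow> 'b::real_normed_vector"
  assumes M: "complete_measure M" and f: "strongly_measurable M f"
    and s: "Bochner_Integration.simple_bochner_integrable M s"
    and t: "Bochner_Integration.simple_bochner_integrable M t"
  shows "ennreal (norm (Bochner_Integration.simple_bochner_integral M s -
      Bochner_Integration.simple_bochner_integral M t)) \<le>
    (\<integral>\<^sup>+x. norm (f x - s x) \<partial>M) + (\<integral>\<^sup>+x. norm (f x - t x) \<partial>M)"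
proof -
  have diff: "(\<lambda>x. norm (f x - r x)) \<in> borel_measurable M"
    if "Bochner_Integration.simple_bochner_integrable M r" for r
  proof -
    have "simple_function M r"
      using that by (auto elim: Bochner_Integration.simple_bochner_integrable.cases)
    then have "strongly_measurable M (\<lambda>x. - r x)"
      unfolding strongly_measurable_def
      by (intro exI[of _ "\<lambda>_ x. - r x"]) (auto intro: simple_function_compose1)
    from strongly_measurable_borel[OF M strongly_measurable_add[OF f this]]
    show ?thesis by simp
  qed
  let ?I = "Bochner_Integration.simple_bochner_integral M"
  have "ennreal (norm (?I s - ?I t)) = norm (?I (\<lambda>x. s x - t x))"
    using s t by (subst Bochner_Integration.simple_bochner_integral_diff) auto
  also have "\<dots> \<le> ?I (\<lambda>x. norm (s x - t x))"
    using Bochner_Integration.simple_bochner_integrable_compose2[of "(-)" M s t] s t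
    by (auto intro!: Bochner_Integration.simple_bochner_integral_norm_bound)
  also have "\<dots> = (\<integral>\<^sup>+x. norm (s x - t x) \<partial>M)"
    using Bochner_Integration.simple_bochner_integrable_compose2[of "\<lambda>x y. norm (x - y)" M s t] s t
    by (auto intro!: Bochner_Integration.simple_bochner_integral_eq_nn_integral)
  also have "\<dots> \<le> (\<integral>\<^sup>+x. ennreal (norm (f x - s x)) + ennreal (norm (f x - t x)) \<partial>M)"
  proof -
    have "norm (s x - t x) \<le> norm (f x - s x) + norm (f x - t x)" for x
      by (metis dual_order.refl norm_diff_triangle_le norm_minus_commute)
    then show ?thesis
      by (metis (mono_tags, lifting) ennreal_leI ennreal_plus nn_integral_mono norm_ge_zero)
  qed
  also have "\<dots> = (\<integral>\<^sup>+x. norm (f x - s x) \<partial>M) + (\<integral>\<^sup>+x. norm (f x - t x) \<partial>M)"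
    by (rule nn_integral_add) (use diff s t in auto)
  finally show ?thesis .
qed

lemma has_strong_integral_unique:
  assumes M: "complete_measure M"
    and "has_strong_integral M f y" "has_strong_integral M f z"
  shows "y = z"
proof -
  let ?I = "Bochner_Integration.simple_bochner_integral M"
  have f: "strongly_measurable M f" using assms(2) by (simp add: has_strong_integral_def)
  obtain s where s: "\<And>i::nat. Bochner_Integration.simple_bochner_integrable M (s i)"
      "(\<lambda>i. \<integral>\<^sup>+x. norm (f x - s i x) \<partial>M) \<longlonglongrightarrow> 0" "(\<lambda>i. ?I (s i)) \<longlonglongrightarrow> y"
    using assms(2) unfolding has_strong_integral_def by blast
  obtain t where t: "\<And>i::nat. Bochner_Integration.simple_bochner_integrable M (t i)"
      "(\<lambda>i. \<integral>\<^sup>+x. norm (f x - t i x) \<partial>M) \<longlonglongrightarrow> 0" "(\<lambda>i. ?I (t i)) \<longlonglongrightarrow> z"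
    using assms(3) unfolding has_strong_integral_def by blast
  have "(\<lambda>i. ennreal (norm (?I (s i) - ?I (t i)))) \<longlonglongrightarrow> ennreal (norm (y - z))"
    by (intro tendsto_ennrealI tendsto_norm tendsto_diff s t)
  moreover have "(\<lambda>i. (\<integral>\<^sup>+x. norm (f x - s i x) \<partial>M) + (\<integral>\<^sup>+x. norm (f x - t i x) \<partial>M)) \<longlonglongrightarrow> 0 + 0"
    by (intro tendsto_add s t)
  ultimately have "ennreal (norm (y - z)) \<le> 0 + 0"
    by (rule LIMSEQ_le) (use simple_bochner_integral_dist[OF M f s(1) t(1)] in blast)
  then show ?thesis by simp
qed

lemma strong_integral_eq:
  assumes "complete_measure M" "has_strong_integral M f y"
  shows "strong_integral M f = y"
  using assms has_strong_integral_unique[OF assms(1)] unfolding strong_integral_def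
  by (auto intro!: the_equality)

lemma strong_integral_cong:
  assumes "\<And>x. x \<in> space M \<Longrightarrow> f x = g x"
  shows "strong_integral M f = strong_integral M g"
proof -
  have "strongly_measurable M f \<longleftrightarrow> strongly_measurable M g"
    unfolding strongly_measurable_def using assms by (simp cong: AE_cong)
  moreover have "(\<integral>\<^sup>+x. norm (f x - s x) \<partial>M) = (\<integral>\<^sup>+x. norm (g x - s x) \<partial>M)" for s
    using assms by (intro nn_integral_cong) simp
  ultimately have "has_strong_integral M f = has_strong_integral M g"
    unfolding has_strong_integral_def by (intro ext) simp
  then show ?thesis unfolding strong_integral_def by (rule arg_cong[where f = "\<lambda>h. if \<exists>y. h y then THE y. h y else 0"])
qed

text \<open>Approximating simple functions may be far from integrable. They are therefore set to zero
  wherever they exceed twice the norm of the limit: where the limit is nonzero this eventually changes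
  nothing, and the truncated functions are dominated, so that they converge in the mean.\<close>

lemma has_strong_integral_exists:
  fixes f :: "'a \<Rightarrow> 'b::banach"
  assumes M: "complete_measure M" and f: "strongly_measurable M f"
    and fin: "(\<integral>\<^sup>+x. norm (f x) \<partial>M) < \<infinity>"
  shows "\<exists>y. has_strong_integral M f y"
proof -
  let ?I = "Bochner_Integration.simple_bochner_integral M"
  have [measurable]: "f \<in> borel_measurable M"
    by (rule strongly_measurable_borel[OF M f])
  obtain s where s: "\<And>i::nat. simple_function M (s i)"
    and lim: "AE x in M. (\<lambda>i. s i x) \<longlonglongrightarrow> f x"
    using f unfolding strongly_measurable_def by blast
  have [measurable]: "s i \<in> borel_measurable M" for i
    using s by (rule borel_measurable_simple_function)
  define t where "t i x = (if norm (s i x) \<le> 2 * norm (f x) then s i x else 0)" for i x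
  have t: "simple_function M (t i)" for i
    unfolding t_def by (intro simple_function_If s simple_function_const) measurable
  have bound: "norm (t i x) \<le> 2 * norm (f x)" for i x
    by (simp add: t_def)
  have tlim: "AE x in M. (\<lambda>i. t i x) \<longlonglongrightarrow> f x"
    using lim
  proof eventually_elim
    fix x assume x: "(\<lambda>i. s i x) \<longlonglongrightarrow> f x"
    show "(\<lambda>i. t i x) \<longlonglongrightarrow> f x"
    proof (cases "f x = 0")
      case True
      then have "t i x = 0" for i using bound[of i x] by simp
      then show ?thesis using True by simp
    next
      case False
      have "\<forall>\<^sub>F i in sequentially. norm (s i x) < 2 * norm (f x)"
        using tendsto_norm[OF x] by (rule order_tendstoD) (use False in simp)
      then have "\<forall>\<^sub>F i in sequentially. s i x = t i x"
        by eventually_elim (simp add: t_def)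
      then show ?thesis using x by (rule Lim_transform_eventually[rotated])
    qed
  qed
  have fin2: "(\<integral>\<^sup>+x. ennreal (c * norm (f x)) \<partial>M) < \<infinity>" if "c \<ge> 0" for c
    using fin that by (simp add: nn_integral_cmult ennreal_mult ennreal_mult_less_top)
  have integrable: "Bochner_Integration.simple_bochner_integrable M (t i)" for i
  proof (rule Bochner_Integration.simple_bochner_integrableI_bounded[OF t])
    have "(\<integral>\<^sup>+x. norm (t i x) \<partial>M) \<le> (\<integral>\<^sup>+x. ennreal (2 * norm (f x)) \<partial>M)"
      using bound by (intro nn_integral_mono ennreal_leI)
    then show "(\<integral>\<^sup>+x. norm (t i x) \<partial>M) < \<infinity>" using fin2[of 2] by (simp add: order_le_less_trans)
  qed
  have conv: "(\<lambda>i. \<integral>\<^sup>+x. norm (f x - t i x) \<partial>M) \<longlonglongrightarrow> 0"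
  proof -
    have "(\<lambda>i. \<integral>\<^sup>+x. norm (0 - norm (f x - t i x)) \<partial>M) \<longlonglongrightarrow> 0"
    proof (rule nn_integral_dominated_convergence_norm[where w = "\<lambda>x. 3 * norm (f x)"])
      fix i
      have "strongly_measurable M (\<lambda>x. - t i x)"
        unfolding strongly_measurable_def
        by (intro exI[of _ "\<lambda>_ x. - t i x"]) (auto intro: simple_function_compose1 t)
      from strongly_measurable_borel[OF M strongly_measurable_add[OF f this]]
      show "(\<lambda>x. norm (f x - t i x)) \<in> borel_measurable M" by simp
      have "norm (f x - t i x) \<le> 3 * norm (f x)" for x
        using norm_triangle_ineq4[of "f x" "t i x"] bound[of i x] by linarith
      then show "AE x in M. norm (norm (f x - t i x)) \<le> 3 * norm (f x)" by simp
    next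
      show "AE x in M. (\<lambda>i. norm (f x - t i x)) \<longlonglongrightarrow> 0"
        using tlim
      proof eventually_elim
        fix x assume "(\<lambda>i. t i x) \<longlonglongrightarrow> f x"
        from tendsto_norm[OF tendsto_diff[OF tendsto_const[of "f x"] this]]
        show "(\<lambda>i. norm (f x - t i x)) \<longlonglongrightarrow> 0" by simp
      qed
    qed (use fin2[of 3] in auto)
    then show ?thesis by simp
  qed
  have "Cauchy (\<lambda>i. ?I (t i))"
  proof (rule metric_CauchyI)
    fix e :: real assume e: "e > 0"
    have "\<forall>\<^sub>F i in sequentially. (\<integral>\<^sup>+x. norm (f x - t i x) \<partial>M) < ennreal (e / 2)"
      using order_tendstoD(2)[OF conv] e by simp
    then obtain N where N: "\<And>i. i \<ge> N \<Longrightarrow> (\<integral>\<^sup>+x. norm (f x - t i x) \<partial>M) < ennreal (e / 2)"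
      unfolding eventually_sequentially by blast
    have "dist (?I (t i)) (?I (t j)) < e" if "i \<ge> N" "j \<ge> N" for i j
    proof -
      have "ennreal (norm (?I (t i) - ?I (t j))) < ennreal (e / 2) + ennreal (e / 2)"
        using simple_bochner_integral_dist[OF M f integrable[of i] integrable[of j]]
          add_strict_mono[OF N[OF that(1)] N[OF that(2)]] by (rule order_le_less_trans)
      then have "ennreal (norm (?I (t i) - ?I (t j))) < ennreal e"
        using e by (simp flip: ennreal_plus)
      then show ?thesis by (simp only: dist_norm ennreal_less_iff norm_ge_zero)
    qed
    then show "\<exists>N. \<forall>i\<ge>N. \<forall>j\<ge>N. dist (?I (t i)) (?I (t j)) < e" by blast
  qed
  then obtain y where "(\<lambda>i. ?I (t i)) \<longlonglongrightarrow> y"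
    by (auto simp: Cauchy_convergent_iff convergent_def)
  then show ?thesis
    unfolding has_strong_integral_def using f integrable conv by blast
qed

text \<open>A bounded functional takes the strong integral to an ordinary scalar integral. Additivity over
  intervals and invariance under translation are later used only through this reduction.\<close>

lemma has_bochner_integral_functional:
  fixes l :: "'b::real_normed_vector \<Rightarrow> 'c::{banach, second_countable_topology}"
  assumes M: "complete_measure M" and l: "bounded_linear l" and "has_strong_integral M f y"
  shows "has_bochner_integral M (\<lambda>x. l (f x)) (l y)"
proof -
  interpret l: bounded_linear l by fact
  let ?I = "Bochner_Integration.simple_bochner_integral M"
  have f: "strongly_measurable M f" using assms(3) by (simp add: has_strong_integral_def)
  obtain s where s: "\<And>i::nat. Bochner_Integration.simple_bochner_integrable M (s i)"
      and conv: "(\<lambda>i. \<integral>\<^sup>+x. norm (f x - s i x) \<partial>M) \<longlonglongrightarrow> 0" and lim: "(\<lambda>i. ?I (s i)) \<longlonglongrightarrow> y"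
    using assms(3) unfolding has_strong_integral_def by blast
  have simple: "simple_function M (s i)" for i
    using s[of i] by (auto elim: Bochner_Integration.simple_bochner_integrable.cases)
  obtain K where K: "K \<ge> 0" "\<And>x. norm (l x) \<le> norm x * K"
    using l.nonneg_bounded by blast
  have cont: "isCont l x" for x by (rule linear_continuous_at[OF l])
  show ?thesis
  proof (rule has_bochner_integral.intros)
    show "(\<lambda>x. l (f x)) \<in> borel_measurable M"
      by (rule strongly_measurable_borel[OF M strongly_measurable_compose[OF f cont]])
    show "Bochner_Integration.simple_bochner_integrable M (\<lambda>x. l (s i x))" for i
      by (rule Bochner_Integration.simple_bochner_integrable_compose2[where p = "\<lambda>a b. l a", OF l.zero s s])
    have "(\<lambda>i. l (?I (s i))) \<longlonglongrightarrow> l y" by (rule l.tendsto[OF lim])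
    moreover have "Bochner_Integration.simple_bochner_integral M (\<lambda>x. l (s i x)) = l (?I (s i))" for i
      by (rule Bochner_Integration.simple_bochner_integral_linear[OF l.linear_axioms s])
    ultimately show "(\<lambda>i. Bochner_Integration.simple_bochner_integral M (\<lambda>x. l (s i x))) \<longlonglongrightarrow> l y"
      by simp
    have "(\<lambda>i. ennreal K * (\<integral>\<^sup>+x. norm (f x - s i x) \<partial>M)) \<longlonglongrightarrow> ennreal K * 0"
      by (rule ennreal_tendsto_cmult[OF _ conv]) simp
    then have *: "(\<lambda>i. ennreal K * (\<integral>\<^sup>+x. norm (f x - s i x) \<partial>M)) \<longlonglongrightarrow> 0" by simp
    have le: "(\<integral>\<^sup>+x. norm (l (f x) - l (s i x)) \<partial>M) \<le> ennreal K * (\<integral>\<^sup>+x. norm (f x - s i x) \<partial>M)"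
      for i
    proof -
      have "strongly_measurable M (\<lambda>x. - s i x)"
        unfolding strongly_measurable_def
        by (intro exI[of _ "\<lambda>_ x. - s i x"]) (auto intro: simple_function_compose1 simple)
      from strongly_measurable_borel[OF M strongly_measurable_add[OF f this]]
      have "(\<lambda>x. norm (f x - s i x)) \<in> borel_measurable M" by simp
      then have "ennreal K * (\<integral>\<^sup>+x. norm (f x - s i x) \<partial>M) = (\<integral>\<^sup>+x. ennreal (norm (f x - s i x) * K) \<partial>M)"
        using K by (subst nn_integral_cmult[symmetric]) (auto simp: ennreal_mult mult.commute)
      moreover have "(\<integral>\<^sup>+x. norm (l (f x) - l (s i x)) \<partial>M) \<le> (\<integral>\<^sup>+x. ennreal (norm (f x - s i x) * K) \<partial>M)"
        using K(2) by (intro nn_integral_mono ennreal_leI) (simp flip: l.diff)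
      ultimately show ?thesis by simp
    qed
    show "(\<lambda>i. \<integral>\<^sup>+x. norm (l (f x) - l (s i x)) \<partial>M) \<longlonglongrightarrow> 0"
      by (rule tendsto_sandwich[OF _ _ tendsto_const *]) (simp_all add: le)
  qed
qed

section \<open>Square-integrable functions\<close>

lemma in_L2_UNIV_iff:
  fixes f :: "real \<Rightarrow> 'b::real_normed_vector"
  assumes "I \<in> sets lebesgue"
  shows "in_L2 I f \<longleftrightarrow> in_L2 UNIV (\<lambda>x. indicator I x *\<^sub>R f x)"
proof -
  have I: "I \<inter> space lebesgue \<in> sets lebesgue" using assms by auto
  have eq: "(\<lambda>x. ennreal ((norm (indicator I x *\<^sub>R f x))\<^sup>2)) =
      (\<lambda>x. ennreal ((norm (f x))\<^sup>2) * indicator I x)"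
    by (auto simp: fun_eq_iff split: split_indicator)
  show ?thesis
    unfolding in_L2_def lebesgue_on_UNIV_eq strongly_measurable_restrict_space[OF assms]
      nn_integral_restrict_space[OF I] eq ..
qed

lemma in_L2_cong_AE:
  assumes "in_L2 I f" "AE x in lebesgue_on I. f x = g x"
  shows "in_L2 I g"
proof -
  have "strongly_measurable (lebesgue_on I) g"
    using assms strongly_measurable_cong_AE unfolding in_L2_def by blast
  moreover have "(\<integral>\<^sup>+t. (norm (f t))\<^sup>2 \<partial>lebesgue_on I) = (\<integral>\<^sup>+t. (norm (g t))\<^sup>2 \<partial>lebesgue_on I)"
    using assms(2) by (intro nn_integral_cong_AE) (auto elim: eventually_mono)
  ultimately show ?thesis using assms(1) unfolding in_L2_def by simp
qed

lemma in_L2_scaleR: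
  fixes f :: "real \<Rightarrow> 'b::real_normed_vector"
  assumes I: "I \<in> sets lebesgue" and "in_L2 I f"
  shows "in_L2 I (\<lambda>x. c *\<^sub>R f x)"
proof -
  have f: "strongly_measurable (lebesgue_on I) f" using assms by (simp add: in_L2_def)
  have [measurable]: "f \<in> borel_measurable (lebesgue_on I)"
    by (rule strongly_measurable_borel[OF complete_measure_lebesgue_on[OF I] f])
  have cont: "isCont (\<lambda>y::'b. c *\<^sub>R y) x" for x by simp
  have "(\<integral>\<^sup>+t. (norm (c *\<^sub>R f t))\<^sup>2 \<partial>lebesgue_on I) =
      (\<integral>\<^sup>+t. ennreal (c\<^sup>2) * (norm (f t))\<^sup>2 \<partial>lebesgue_on I)"
    by (intro nn_integral_cong) (simp add: power_mult_distrib ennreal_mult)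
  also have "\<dots> = ennreal (c\<^sup>2) * (\<integral>\<^sup>+t. (norm (f t))\<^sup>2 \<partial>lebesgue_on I)"
    by (rule nn_integral_cmult) measurable
  also have "\<dots> < \<infinity>" using assms(2) by (simp add: in_L2_def ennreal_mult_less_top)
  finally show ?thesis
    using strongly_measurable_compose[OF f cont] by (simp add: in_L2_def)
qed

lemma in_L2_add:
  fixes f g :: "real \<Rightarrow> 'b::real_normed_vector"
  assumes I: "I \<in> sets lebesgue" and "in_L2 I f" "in_L2 I g"
  shows "in_L2 I (\<lambda>x. f x + g x)"
proof -
  have f: "strongly_measurable (lebesgue_on I) f" and g: "strongly_measurable (lebesgue_on I) g"
    using assms by (simp_all add: in_L2_def)
  note M = complete_measure_lebesgue_on[OF I]
  have [measurable]: "f \<in> borel_measurable (lebesgue_on I)" "g \<in> borel_measurable (lebesgue_on I)"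
    using strongly_measurable_borel[OF M] f g by auto
  have "(norm (x + y))\<^sup>2 \<le> 2 * (norm x)\<^sup>2 + 2 * (norm y)\<^sup>2" for x y :: 'b
  proof -
    have "(norm (x + y))\<^sup>2 \<le> (norm x + norm y)\<^sup>2"
      by (intro power_mono norm_triangle_ineq) simp
    then show ?thesis using sum_squares_bound[of "norm x" "norm y"]
      by (simp add: power2_sum)
  qed
  then have "(\<integral>\<^sup>+t. (norm (f t + g t))\<^sup>2 \<partial>lebesgue_on I) \<le>
      (\<integral>\<^sup>+t. ennreal 2 * (norm (f t))\<^sup>2 + ennreal 2 * (norm (g t))\<^sup>2 \<partial>lebesgue_on I)"
    by (intro nn_integral_mono)
      (simp flip: ennreal_mult ennreal_plus add: ennreal_leI del: ennreal_numeral)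
  also have "\<dots> = 2 * (\<integral>\<^sup>+t. (norm (f t))\<^sup>2 \<partial>lebesgue_on I) +
      2 * (\<integral>\<^sup>+t. (norm (g t))\<^sup>2 \<partial>lebesgue_on I)"
    by (subst nn_integral_add) (auto simp: nn_integral_cmult)
  also have "\<dots> < \<infinity>" using assms(2,3) by (simp add: in_L2_def ennreal_mult_less_top)
  finally show ?thesis
    using strongly_measurable_add[OF f g] by (simp add: in_L2_def)
qed

lemma in_L2_subset:
  fixes f :: "real \<Rightarrow> 'b::real_normed_vector"
  assumes I: "I \<in> sets lebesgue" "in_L2 I f" and J: "J \<in> sets lebesgue" "J \<subseteq> I"
  shows "in_L2 J f"
proof -
  let ?g = "\<lambda>x. indicator I x *\<^sub>R f x"
  have g: "strongly_measurable lebesgue ?g" "(\<integral>\<^sup>+t. (norm (?g t))\<^sup>2 \<partial>lebesgue) < \<infinity>"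
    using I in_L2_UNIV_iff[OF I(1)] by (auto simp: in_L2_def lebesgue_on_UNIV_eq)
  have eq: "(\<lambda>x. indicator J x *\<^sub>R f x) = (\<lambda>x. indicator J x *\<^sub>R ?g x)"
    using J(2) by (auto simp: fun_eq_iff split: split_indicator)
  obtain s where s: "\<And>i::nat. simple_function lebesgue (s i)"
    and lim: "AE x in lebesgue. (\<lambda>i. s i x) \<longlonglongrightarrow> ?g x"
    using g(1) unfolding strongly_measurable_def by blast
  have "simple_function lebesgue (\<lambda>x. indicator J x *\<^sub>R s i x)" for i
    by (rule simple_function_compose2[OF simple_function_indicator s, of _ "\<lambda>a b. a *\<^sub>R b"])
      (use J in auto)
  moreover have "AE x in lebesgue. (\<lambda>i. indicator J x *\<^sub>R s i x) \<longlonglongrightarrow> indicator J x *\<^sub>R ?g x"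
    using lim by eventually_elim (rule tendsto_scaleR[OF tendsto_const])
  ultimately have "strongly_measurable lebesgue (\<lambda>x. indicator J x *\<^sub>R ?g x)"
    unfolding strongly_measurable_def by (intro exI[of _ "\<lambda>i x. indicator J x *\<^sub>R s i x"]) blast
  moreover have "(\<integral>\<^sup>+t. (norm (indicator J t *\<^sub>R ?g t))\<^sup>2 \<partial>lebesgue) \<le> (\<integral>\<^sup>+t. (norm (?g t))\<^sup>2 \<partial>lebesgue)"
    by (intro nn_integral_mono) (auto split: split_indicator)
  ultimately show ?thesis
    using g(2) unfolding in_L2_UNIV_iff[OF J(1)] eq
    by (auto simp: in_L2_def lebesgue_on_UNIV_eq)
qed

lemma in_L2_shift:
  fixes f :: "real \<Rightarrow> 'b::real_normed_vector"
  assumes "in_L2 UNIV f"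
  shows "in_L2 UNIV (\<lambda>x. f (x + a))"
proof -
  have f: "strongly_measurable lebesgue f" and fin: "(\<integral>\<^sup>+t. (norm (f t))\<^sup>2 \<partial>lebesgue) < \<infinity>"
    using assms by (auto simp: in_L2_def lebesgue_on_UNIV_eq)
  have "complete_measure (lebesgue :: real measure)"
    using complete_measure_lebesgue_on[of UNIV] by (simp add: lebesgue_on_UNIV_eq)
  from strongly_measurable_borel[OF this f] have [measurable]: "f \<in> borel_measurable lebesgue" .
  have "(\<lambda>t. ennreal ((norm (f t))\<^sup>2)) \<in> borel_measurable lebesgue" by measurable
  from nn_integral_real_affine_lebesgue[OF this, of 1 a]
  have "(\<integral>\<^sup>+t. (norm (f (t + a)))\<^sup>2 \<partial>lebesgue) < \<infinity>" using fin by (simp add: add.commute)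
  then show ?thesis
    using strongly_measurable_shift[OF f] by (simp add: in_L2_def lebesgue_on_UNIV_eq)
qed

text \<open>After extension by zero, the function is the sum of its first piece and of its translated second
  piece, except at the common end point.\<close>

lemma in_L2_append:
  fixes v :: "real \<Rightarrow> 'b::real_normed_vector"
  assumes "a \<ge> 0" "b \<ge> 0" and v: "in_L2 {0<..<a} v" "in_L2 {0<..<b} (\<lambda>s. v (s + a))"
  shows "in_L2 {0<..<a + b} v"
proof -
  have "in_L2 UNIV (\<lambda>x. indicator {0<..<a} x *\<^sub>R v x +
      indicator {0<..<b} (x + - a) *\<^sub>R v (x + - a + a))"
    using v in_L2_UNIV_iff[of "{0<..<a}" v] in_L2_UNIV_iff[of "{0<..<b}" "\<lambda>s. v (s + a)"]
    by (intro in_L2_add in_L2_shift[of "\<lambda>x. indicator {0<..<b} x *\<^sub>R v (x + a)" "- a"]) auto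
  moreover have "AE x in lebesgue_on UNIV. indicator {0<..<a} x *\<^sub>R v x +
      indicator {0<..<b} (x + - a) *\<^sub>R v (x + - a + a) = indicator {0<..<a + b} x *\<^sub>R v x"
  proof -
    have "AE x in lebesgue. x \<noteq> a"
      using AE_completion[OF AE_lborel_singleton[of a]] .
    then have "AE x in lebesgue. indicator {0<..<a} x *\<^sub>R v x +
      indicator {0<..<b} (x + - a) *\<^sub>R v (x + - a + a) = indicator {0<..<a + b} x *\<^sub>R v x"
      by eventually_elim (use assms(1,2) in \<open>auto split: split_indicator\<close>)
    then show ?thesis unfolding lebesgue_on_UNIV_eq .
  qed
  ultimately have "in_L2 UNIV (\<lambda>x. indicator {0<..<a + b} x *\<^sub>R v x)"
    by (rule in_L2_cong_AE)
  then show ?thesis using in_L2_UNIV_iff[of "{0<..<a + b}" v] by simp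
qed

lemma in_L2_imp_L1:
  fixes v :: "real \<Rightarrow> 'b::real_normed_vector"
  assumes v: "in_L2 {0<..<a} v"
  shows "(\<integral>\<^sup>+t. norm (v t) \<partial>lebesgue_on {0<..<a}) < \<infinity>"
proof -
  have f: "strongly_measurable (lebesgue_on {0<..<a}) v" using assms by (simp add: in_L2_def)
  have [measurable]: "v \<in> borel_measurable (lebesgue_on {0<..<a})"
    by (rule strongly_measurable_borel[OF complete_measure_lebesgue_on f]) simp
  have "x \<le> 1 + x\<^sup>2" for x :: real
  proof -
    have "2 * x \<le> x\<^sup>2 + 1" using zero_le_power2[of "x - 1"] by (simp add: power2_diff)
    then show ?thesis using zero_le_power2[of x] by linarith
  qed
  then have "(\<integral>\<^sup>+t. norm (v t) \<partial>lebesgue_on {0<..<a}) \<le>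
      (\<integral>\<^sup>+t. ennreal 1 + (norm (v t))\<^sup>2 \<partial>lebesgue_on {0<..<a})"
    by (intro nn_integral_mono) (simp flip: ennreal_plus add: ennreal_leI del: ennreal_1)
  also have "\<dots> = emeasure (lebesgue_on {0<..<a}) (space (lebesgue_on {0<..<a})) +
      (\<integral>\<^sup>+t. (norm (v t))\<^sup>2 \<partial>lebesgue_on {0<..<a})"
    by (subst nn_integral_add) auto
  also have "\<dots> < \<infinity>"
    using v by (cases "0 \<le> a") (auto simp: in_L2_def emeasure_restrict_space)
  finally show ?thesis .
qed

section \<open>Semigroups on Banach spaces\<close>

lemma C0_semigroup_bounded_linear:
  assumes "C0_semigroup S" "t \<ge> 0"
  shows "bounded_linear (S t)"
  using assms unfolding C0_semigroup_def bounded_clinear_def by blast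

lemma C0_semigroup_isCont_0:
  assumes "C0_semigroup S"
  shows "isCont (\<lambda>h. S \<bar>h\<bar> x) 0"
  unfolding continuous_at_eps_delta
proof (intro allI impI)
  fix e :: real assume "e > 0"
  have S0: "S 0 x = x" and lim: "((\<lambda>t. S t x) \<longlongrightarrow> x) (at_right 0)"
    using assms unfolding C0_semigroup_def by auto
  from tendstoD[OF lim \<open>e > 0\<close>] obtain b where b: "b > 0" "\<And>h. 0 < h \<Longrightarrow> h < b \<Longrightarrow> dist (S h x) x < e"
    unfolding eventually_at_right_field by auto
  have "dist (S \<bar>h\<bar> x) (S \<bar>0\<bar> x) < e" if "dist h 0 < b" for h
    using b(2)[of "\<bar>h\<bar>"] that S0 \<open>e > 0\<close> by (cases "h = 0") (auto simp: dist_real_def)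
  then show "\<exists>s>0. \<forall>h. dist h 0 < s \<longrightarrow> dist (S \<bar>h\<bar> x) (S \<bar>0\<bar> x) < e"
    using b(1) by blast
qed

text \<open>The uniform boundedness principle. Every orbit is bounded near time \<open>0\<close>, so the closed sets of
  vectors whose orbit stays below \<open>n\<close> up to time \<open>1/(n+1)\<close> exhaust the space, and by Baire one
  of them contains a ball. This bounds the operator norm on a short time interval, and the semigroup law
  propagates the bound.\<close>

lemma C0_semigroup_locally_bounded:
  fixes S :: "real \<Rightarrow> 'a \<Rightarrow> 'a::{complex_normed_vector, banach}"
  assumes S: "C0_semigroup S"
  shows "\<exists>K\<ge>0. \<forall>t\<in>{0..T}. \<forall>x. norm (S t x) \<le> K * norm x"
proof -
  note lin = C0_semigroup_bounded_linear[OF S]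
  define E where "E n = {x. \<forall>t\<in>{0..1 / real (Suc n)}. norm (S t x) \<le> real n}" for n
  have "\<exists>n. x \<in> E n" for x
  proof -
    from tendstoD[OF isContD[OF C0_semigroup_isCont_0[OF S, of x]], of 1]
    obtain b where b: "b > 0" "\<And>h. h \<noteq> 0 \<Longrightarrow> dist h 0 < b \<Longrightarrow> dist (S \<bar>h\<bar> x) (S 0 x) < 1"
      by (auto simp: eventually_at)
    obtain n1 where n1: "inverse (real (Suc n1)) < b" using b(1) reals_Archimedean by blast
    obtain n2 :: nat where n2: "norm x + 1 \<le> real n2" using real_arch_simple by blast
    have S0: "S 0 x = x" using S by (simp add: C0_semigroup_def)
    have "norm (S t x) \<le> real (max n1 n2)" if "t \<in> {0..1 / real (Suc (max n1 n2))}" for t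
    proof (cases "t = 0")
      case True then show ?thesis using n2 S0 by simp
    next
      case False
      have "1 / real (Suc (max n1 n2)) \<le> 1 / real (Suc n1)" by (simp add: frac_le)
      then have "t < b" using that n1 by (simp add: inverse_eq_divide)
      then have "dist (S t x) x < 1" using b(2)[of t] that False S0 by (simp add: dist_real_def)
      then have "norm (S t x) < norm x + 1"
        using norm_triangle_ineq2[of "S t x" x] by (simp add: dist_norm)
      then show ?thesis using n2 by simp
    qed
    then show ?thesis unfolding E_def by blast
  qed
  then have empty: "\<Inter>(range (\<lambda>n. - E n)) = {}" by auto
  have closed: "closed (E n)" for n
  proof -
    have "closed {x. norm (S t x) \<le> real n}" if "t \<in> {0..1 / real (Suc n)}" for t
      by (intro closed_Collect_le continuous_intros bounded_linear.continuous_on[OF lin])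
        (use that in auto)
    then have "closed (\<Inter>t\<in>{0..1 / real (Suc n)}. {x. norm (S t x) \<le> real n})" by blast
    moreover have "E n = (\<Inter>t\<in>{0..1 / real (Suc n)}. {x. norm (S t x) \<le> real n})"
      by (auto simp: E_def)
    ultimately show ?thesis by simp
  qed
  \<comment> \<open>If all complements were dense, so would be their intersection, which is empty.\<close>
  have "\<exists>n. closure (- E n) \<noteq> UNIV"
  proof (rule ccontr)
    assume "\<nexists>n. closure (- E n) \<noteq> UNIV"
    then have "euclidean closure_of (\<Inter>(range (\<lambda>n. - E n))) = (UNIV :: 'a set)"
      using Met_TC.metric_Baire_category[of "range (\<lambda>n. - E n)"] closed
      by (auto simp: open_Compl complete_UNIV)
    then show False unfolding empty by simp
  qed
  then obtain n x0 where "x0 \<in> interior (E n)"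
    by (auto simp: closure_complement)
  then obtain r where r: "r > 0" "ball x0 r \<subseteq> E n"
    using mem_interior by blast
  define d where "d = 1 / real (Suc n)"
  have d: "d > 0" by (simp add: d_def)
  define K where "K = max 1 (4 * real n / r)"
  have step: "norm (S t y) \<le> K * norm y" if t: "0 \<le> t" "t \<le> d" for t y
  proof (cases "y = 0")
    case True
    then show ?thesis using linear_0[OF bounded_linear.linear[OF lin[OF t(1)]]] by simp
  next
    case False
    \<comment> \<open>Scales \<open>y\<close> to length \<open>r/2\<close>, so that it can be added to the centre without leaving the ball.\<close>
    define c where "c = r / (2 * norm y)"
    have c: "c > 0" using r False by (simp add: c_def)
    have "x0 + c *\<^sub>R y \<in> ball x0 r" "x0 \<in> ball x0 r"
      using r False by (auto simp: dist_norm c_def)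
    then have "x0 + c *\<^sub>R y \<in> E n" "x0 \<in> E n"
      using r(2) by blast+
    then have "norm (S t (x0 + c *\<^sub>R y)) \<le> real n" "norm (S t x0) \<le> real n"
      using t unfolding E_def d_def by auto
    moreover have "S t (x0 + c *\<^sub>R y) - S t x0 = c *\<^sub>R S t y"
      using bounded_linear.linear[OF lin[OF t(1)]] by (simp add: linear_add linear_scale)
    ultimately have "norm (c *\<^sub>R S t y) \<le> 2 * real n"
      using norm_triangle_ineq4[of "S t (x0 + c *\<^sub>R y)" "S t x0"] by simp
    then have "c * norm (S t y) \<le> 2 * real n" using c by simp
    then have "norm (S t y) \<le> 2 * real n / c" using c by (simp add: field_simps)
    also have "\<dots> = 4 * real n / r * norm y" using r False by (simp add: c_def)
    also have "\<dots> \<le> K * norm y" unfolding K_def by (intro mult_right_mono) auto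
    finally show ?thesis .
  qed
  have K: "K \<ge> 1" by (simp add: K_def)
  have power: "norm (S t x) \<le> K ^ m * norm x" if "0 \<le> t" "t \<le> real m * d" for m t x
    using that
  proof (induction m arbitrary: t)
    case 0
    then show ?case using S by (simp add: C0_semigroup_def)
  next
    case (Suc m)
    show ?case
    proof (cases "t \<le> real m * d")
      case True
      then have "norm (S t x) \<le> K ^ m * norm x" using Suc by simp
      also have "\<dots> \<le> K ^ Suc m * norm x" using K by (intro mult_right_mono power_increasing) auto
      finally show ?thesis .
    next
      case False
      define s where "s = t - real m * d"
      have s: "0 \<le> s" "s \<le> d" using False Suc.prems by (auto simp: s_def algebra_simps)
      have m: "0 \<le> real m * d" using d by simp
      have "S t x = S s (S (real m * d) x)"
        using S s m unfolding C0_semigroup_def s_def by (metis add.commute diff_add_cancel)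
      then have "norm (S t x) \<le> K * norm (S (real m * d) x)" using step[OF s] by simp
      also have "\<dots> \<le> K * (K ^ m * norm x)" using Suc.IH[OF m] K by (intro mult_left_mono) auto
      finally show ?thesis by (simp add: mult_ac)
    qed
  qed
  obtain m :: nat where "T / d \<le> real m" using real_arch_simple by blast
  then have "T \<le> real m * d" using d by (simp add: field_simps)
  then show ?thesis using power K by (intro exI[of _ "K ^ m"]) auto
qed

text \<open>Two values of an orbit differ by \<open>S a (S \<bar>t - t0\<bar> x - x)\<close>, where \<open>a\<close> is the smaller of the two times;
  the bound on \<open>S a\<close>, uniform in \<open>a\<close>, is what yields continuity from the left.\<close>

lemma C0_semigroup_continuous_on:
  fixes S :: "real \<Rightarrow> 'a \<Rightarrow> 'a::{complex_normed_vector, banach}"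
  assumes S: "C0_semigroup S"
  shows "continuous_on {0..} (\<lambda>t. S t x)"
  unfolding continuous_on
proof
  fix t0 :: real assume t0: "t0 \<in> {0..}"
  have add: "S (s + t) y = S s (S t y)" if "s \<ge> 0" "t \<ge> 0" for s t y
    using S that unfolding C0_semigroup_def by blast
  obtain K' where K': "K' \<ge> 0" "\<And>t y. t \<in> {0..t0 + 1} \<Longrightarrow> norm (S t y) \<le> K' * norm y"
    using C0_semigroup_locally_bounded[OF S, of "t0 + 1"] by blast
  have bound: "norm (S t x - S t0 x) \<le> K' * norm (S \<bar>t - t0\<bar> x - x)" if t: "t \<ge> 0" "t < t0 + 1" for t
  proof -
    define a where "a = min t t0"
    have a: "a \<ge> 0" "a \<in> {0..t0 + 1}" using t t0 by (auto simp: a_def)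
    have "norm (S t x - S t0 x) = norm (S a (S \<bar>t - t0\<bar> x) - S a x)"
    proof (cases "t \<le> t0")
      case True
      then have "S t0 x = S a (S \<bar>t - t0\<bar> x)" "S t x = S a x"
        using add[of a "\<bar>t - t0\<bar>" x] a by (auto simp: a_def)
      then show ?thesis by (simp add: norm_minus_commute)
    next
      case False
      then have "S t x = S a (S \<bar>t - t0\<bar> x)" "S t0 x = S a x"
        using add[of a "\<bar>t - t0\<bar>" x] a by (auto simp: a_def)
      then show ?thesis by simp
    qed
    also have "\<dots> = norm (S a (S \<bar>t - t0\<bar> x - x))"
      using linear_diff[OF bounded_linear.linear[OF C0_semigroup_bounded_linear[OF S a(1)]]] by simp
    finally show ?thesis using K'(2)[OF a(2)] by simp
  qed
  have "((\<lambda>t. S \<bar>t - t0\<bar> x) \<longlongrightarrow> S \<bar>0\<bar> x) (at t0 within {0..})"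
    by (rule isCont_tendsto_compose[OF C0_semigroup_isCont_0[OF S]])
      (rule tendsto_eq_intros refl | simp)+
  then have "((\<lambda>t. S \<bar>t - t0\<bar> x - x) \<longlongrightarrow> 0) (at t0 within {0..})"
    using S by (simp add: C0_semigroup_def LIM_zero)
  then have lim: "((\<lambda>t. K' * norm (S \<bar>t - t0\<bar> x - x)) \<longlongrightarrow> 0) (at t0 within {0..})"
    using tendsto_mult_right_zero tendsto_norm_zero by blast
  have "((\<lambda>t. S t x - S t0 x) \<longlongrightarrow> 0) (at t0 within {0..})"
  proof (rule Lim_null_comparison[OF _ lim])
    have "\<forall>\<^sub>F t in at t0 within {0..}. t < t0 + 1"
      by (rule order_tendstoD[OF tendsto_ident_at]) simp
    moreover have "\<forall>\<^sub>F t in at t0 within {0..}. t \<in> {0..}"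
      by (simp add: eventually_at_filter)
    ultimately show "\<forall>\<^sub>F t in at t0 within {0..}. norm (S t x - S t0 x) \<le> K' * norm (S \<bar>t - t0\<bar> x - x)"
      by eventually_elim (use bound in auto)
  qed
  then show "((\<lambda>t. S t x) \<longlongrightarrow> S t0 x) (at t0 within {0..})"
    by (rule LIM_zero_cancel)
qed

text \<open>Integrals over orbits serve as mollifiers: they lie in the domain of the generator and, divided by
  \<open>h\<close>, converge to the initial point.\<close>

definition orbit_integral :: "(real \<Rightarrow> 'a \<Rightarrow> 'a::real_normed_vector) \<Rightarrow> real \<Rightarrow> 'a \<Rightarrow> 'a" where
  "orbit_integral S h x = integral {0..h} (\<lambda>t. S t x)"

lemma orbit_integrable:
  fixes S :: "real \<Rightarrow> 'a \<Rightarrow> 'a::{complex_normed_vector, banach}"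
  assumes "C0_semigroup S" "a \<ge> 0"
  shows "(\<lambda>t. S t x) integrable_on {a..b}"
  by (rule integrable_continuous_interval continuous_on_subset[OF C0_semigroup_continuous_on])+
    (use assms in auto)

lemma orbit_integral_derivative:
  fixes S :: "real \<Rightarrow> 'a \<Rightarrow> 'a::{complex_normed_vector, banach}"
  assumes S: "C0_semigroup S" and u: "u \<ge> 0"
  shows "((\<lambda>s. (orbit_integral S (u + s) x - orbit_integral S u x) /\<^sub>R s) \<longlongrightarrow> S u x) (at_right 0)"
proof -
  have cont: "continuous_on {0..u + 1} (\<lambda>t. S t x)"
    by (rule continuous_on_subset[OF C0_semigroup_continuous_on[OF S]]) auto
  have "((\<lambda>v. orbit_integral S v x) has_vector_derivative S u x) (at u within {0..u + 1})"
    unfolding orbit_integral_def by (rule integral_has_vector_derivative[OF cont]) (use u in auto)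
  then have "((\<lambda>v. orbit_integral S v x) has_vector_derivative S u x) (at u within {u..u + 1})"
    by (rule has_vector_derivative_within_subset) (use u in auto)
  then have "((\<lambda>v. orbit_integral S v x) has_vector_derivative S u x) (at_right u)"
    by (simp add: at_within_Icc_at_right)
  then have "((\<lambda>v. (orbit_integral S v x - orbit_integral S u x - (v - u) *\<^sub>R S u x) /\<^sub>R norm (v - u))
      \<longlongrightarrow> 0) (at_right u)"
    unfolding has_vector_derivative_def has_derivative_at_within by blast
  then have *: "((\<lambda>s. (orbit_integral S (s + u) x - orbit_integral S u x - s *\<^sub>R S u x) /\<^sub>R \<bar>s\<bar>)
      \<longlongrightarrow> 0) (at_right 0)"
    unfolding filterlim_at_right_to_0[of _ _ u] by simp
  have "((\<lambda>s. (orbit_integral S (u + s) x - orbit_integral S u x) /\<^sub>R s - S u x) \<longlongrightarrow> 0) (at_right 0)"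
    using * by (rule Lim_transform_eventually)
      (auto simp: eventually_at_filter scaleR_diff_right add.commute)
  then show ?thesis by (rule LIM_zero_cancel)
qed

lemma orbit_integral_shift:
  fixes S :: "real \<Rightarrow> 'a \<Rightarrow> 'a::{complex_normed_vector, banach}"
  assumes S: "C0_semigroup S" and h: "h \<ge> 0" and s: "s \<ge> 0"
  shows "orbit_integral S h (S s x) = orbit_integral S (h + s) x - orbit_integral S s x"
proof -
  have "orbit_integral S h (S s x) = integral {0..h} (\<lambda>t. S (t + s) x)"
    unfolding orbit_integral_def using S s by (intro integral_cong) (auto simp: C0_semigroup_def)
  also have "\<dots> = integral {s - s..(h + s) - s} (\<lambda>t. S (t + s) x)" by simp
  also have "\<dots> = integral {s..h + s} (\<lambda>t. S t x)"
    by (rule integral_shift_real_ivl)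
  also have "\<dots> = orbit_integral S (h + s) x - orbit_integral S s x"
    unfolding orbit_integral_def
    using Henstock_Kurzweil_Integration.integral_combine[OF s _ orbit_integrable[OF S order_refl], of "h + s" x] h
    by (simp add: algebra_simps)
  finally show ?thesis .
qed

text \<open>The formula \<open>A (\<integral> S t x dt) = S h x - x\<close>, with the difference quotient of the generator not yet
  moved out of the integral. Moved outside, it shows that the integral lies in the domain; kept inside, for
  \<open>x\<close> in the domain, it evaluates the integral of \<open>S t (A x)\<close>.\<close>

lemma orbit_integral_difference_quotient:
  fixes S :: "real \<Rightarrow> 'a \<Rightarrow> 'a::{complex_normed_vector, banach}"
  assumes S: "C0_semigroup S" and h: "h \<ge> 0"
  shows "((\<lambda>s. (orbit_integral S h (S s x) - orbit_integral S h x) /\<^sub>R s) \<longlongrightarrow> S h x - x) (at_right 0)"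
proof -
  have zero: "orbit_integral S 0 x = 0" by (simp add: orbit_integral_def)
  have "((\<lambda>s. (orbit_integral S (h + s) x - orbit_integral S h x) /\<^sub>R s -
      (orbit_integral S (0 + s) x - orbit_integral S 0 x) /\<^sub>R s) \<longlongrightarrow> S h x - S 0 x) (at_right 0)"
    by (intro tendsto_diff orbit_integral_derivative S h) simp
  moreover have "\<forall>\<^sub>F s in at_right 0. (orbit_integral S (h + s) x - orbit_integral S h x) /\<^sub>R s -
      (orbit_integral S (0 + s) x - orbit_integral S 0 x) /\<^sub>R s =
      (orbit_integral S h (S s x) - orbit_integral S h x) /\<^sub>R s"
    by (rule eventually_mono[OF eventually_at_right_less])
      (simp add: orbit_integral_shift[OF S h] zero scaleR_diff_right)
  ultimately show ?thesis
    using S by (auto simp: C0_semigroup_def elim: Lim_transform_eventually)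
qed

lemma orbit_integral_mean:
  fixes S :: "real \<Rightarrow> 'a \<Rightarrow> 'a::{complex_normed_vector, banach}"
  assumes S: "C0_semigroup S"
  shows "((\<lambda>h. orbit_integral S h x /\<^sub>R h) \<longlongrightarrow> x) (at_right 0)"
  using orbit_integral_derivative[OF S order_refl, of x] S
  by (simp add: orbit_integral_def C0_semigroup_def)

lemma bounded_linear_scaleC: "bounded_linear (\<lambda>x :: 'a::complex_normed_vector. c *\<^sub>C x)"
proof (rule bounded_linear_intro[where K = "cmod c"])
  show "c *\<^sub>C (r *\<^sub>R x) = r *\<^sub>R (c *\<^sub>C x)" for r and x :: 'a
    by (simp add: scaleC_scaleC mult.commute flip: scaleC_of_real)
qed (simp_all add: scaleC_add_right norm_scaleC mult.commute)

lemma orbit_integral_bounded_clinear: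
  fixes S :: "real \<Rightarrow> 'a \<Rightarrow> 'a::{complex_normed_vector, banach}"
  assumes S: "C0_semigroup S" and h: "h \<ge> 0"
  shows "bounded_clinear (orbit_integral S h)"
proof -
  note int = orbit_integrable[OF S order_refl]
  have lin: "linear (S t)" if "t \<ge> 0" for t
    using C0_semigroup_bounded_linear[OF S that] by (rule bounded_linear.linear)
  obtain K where K: "K \<ge> 0" "\<And>t y. t \<in> {0..h} \<Longrightarrow> norm (S t y) \<le> K * norm y"
    using C0_semigroup_locally_bounded[OF S, of h] by blast
  have "orbit_integral S h (c *\<^sub>C x) = c *\<^sub>C orbit_integral S h x" for c x
  proof -
    have "orbit_integral S h (c *\<^sub>C x) = integral {0..h} ((\<lambda>y. c *\<^sub>C y) \<circ> (\<lambda>t. S t x))"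
      unfolding orbit_integral_def using S
      by (intro integral_cong) (auto simp: C0_semigroup_def bounded_clinear_def)
    then show ?thesis
      unfolding orbit_integral_def using integral_linear[OF int bounded_linear_scaleC] by metis
  qed
  moreover have "bounded_linear (orbit_integral S h)"
  proof (rule bounded_linear_intro[where K = "K * h"])
    fix x y r
    have "orbit_integral S h (x + y) = integral {0..h} (\<lambda>t. S t x + S t y)"
      unfolding orbit_integral_def using lin by (intro integral_cong) (auto simp: linear_add)
    then show "orbit_integral S h (x + y) = orbit_integral S h x + orbit_integral S h y"
      by (simp add: integral_add[OF int int] orbit_integral_def)
    have "orbit_integral S h (r *\<^sub>R x) = integral {0..h} (\<lambda>t. r *\<^sub>R S t x)"
      unfolding orbit_integral_def using lin by (intro integral_cong) (auto simp: linear_scale)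
    then show "orbit_integral S h (r *\<^sub>R x) = r *\<^sub>R orbit_integral S h x"
      by (simp add: orbit_integral_def)
    have "norm (orbit_integral S h x) \<le> (K * norm x) * (h - 0)"
      unfolding orbit_integral_def using h K(2)
      by (intro integral_bound continuous_on_subset[OF C0_semigroup_continuous_on[OF S]]) auto
    then show "norm (orbit_integral S h x) \<le> norm x * (K * h)" by (simp add: mult_ac)
  qed
  ultimately show ?thesis by (simp add: bounded_clinear_def)
qed

section \<open>Adjoints in a Hilbert space\<close>

lemma cinner_add_right: "cinner x (y + z) = cinner x y + cinner x z"
  for x :: "'a::complex_inner"
  by (metis cinner_add_left cinner_commute complex_cnj_add)

lemma cinner_scaleC_right: "cinner x (c *\<^sub>C y) = cnj c * cinner x y"
  for x :: "'a::complex_inner"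
  by (metis cinner_commute cinner_scaleC_left complex_cnj_mult)

lemma norm_cinner_le: "cmod (cinner x y) \<le> norm x * norm y"
  for x :: "'a::complex_inner"
proof (cases "cinner x y = 0")
  case False
  define c where "c = cnj (cinner x y) / cmod (cinner x y)"
  have "cmod c = 1" using False by (simp add: c_def norm_divide)
  have "c * cinner x y = complex_of_real (cmod (cinner x y))"
    using False complex_norm_square[of "cinner x y"]
    by (simp add: c_def field_simps power2_eq_square)
  then have "inner (c *\<^sub>C x) y = cmod (cinner x y)"
    unfolding inner_eq_Re_cinner cinner_scaleC_left by simp
  then show ?thesis
    using norm_cauchy_schwarz[of "c *\<^sub>C x" y] \<open>cmod c = 1\<close> by (simp add: norm_scaleC)
qed simp

lemma cinner_zero_right: "cinner x 0 = 0"
  for x :: "'a::complex_inner"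
  using cinner_add_right[of x 0 0] by simp

lemma bounded_linear_cinner_left: "bounded_linear (\<lambda>x. cinner x y)"
  for y :: "'a::complex_inner"
proof (rule bounded_linear_intro[where K = "norm y"])
  show "cinner (r *\<^sub>R x) y = r *\<^sub>R cinner x y" for r and x :: 'a
    using cinner_scaleC_left[of "complex_of_real r" x y] by (simp add: scaleC_of_real scaleR_conv_of_real)
qed (simp_all add: cinner_add_left norm_cinner_le)

lemma cinner_eq_zero_imp:
  fixes x :: "'a::complex_inner"
  assumes "\<And>y. cinner x y = 0"
  shows "x = 0"
  using assms[of x] inner_eq_Re_cinner[of x x] by simp

text \<open>The representing vector minimizes \<open>\<parallel>x\<parallel>\<^sup>2 / 2 - l x\<close>. By the parallelogram law every minimizing
  sequence is Cauchy, and the first variation vanishes at the limit.\<close>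

lemma riesz_representation:
  fixes l :: "'a::{real_inner, banach} \<Rightarrow> real"
  assumes l: "bounded_linear l"
  shows "\<exists>z. \<forall>x. l x = inner x z"
proof -
  interpret l: bounded_linear l by fact
  define J where "J x = (norm x)\<^sup>2 / 2 - l x" for x
  obtain K where K: "\<And>x. norm (l x) \<le> norm x * K" using l.bounded by blast
  have below: "- K\<^sup>2 / 2 \<le> J x" for x
    using K[of x] zero_le_power2[of "norm x - K"] by (simp add: J_def power2_diff)
  define m where "m = Inf (range J)"
  have bdd: "bdd_below (range J)" using below by (auto intro!: bdd_belowI)
  have m: "m \<le> J x" for x unfolding m_def by (rule cINF_lower[OF bdd]) simp
  \<comment> \<open>The parallelogram law, in which the linear part of \<open>J\<close> cancels.\<close>
  have mid: "(norm (x - y))\<^sup>2 = 4 * J x + 4 * J y - 8 * J ((1/2) *\<^sub>R (x + y))" for x y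
    by (simp add: J_def l.scaleR l.add power_mult_distrib power2_norm_eq_inner inner_simps
        inner_commute algebra_simps)
  have "\<exists>x. J x < m + 1 / real (Suc n)" for n
    using cInf_lessD[of "range J" "m + 1 / real (Suc n)"] by (auto simp: m_def)
  then obtain X where X: "\<And>n. J (X n) < m + 1 / real (Suc n)" by metis
  have "Cauchy X"
  proof (rule metric_CauchyI)
    fix e :: real assume e: "e > 0"
    obtain N where N: "inverse (real (Suc N)) < e\<^sup>2 / 8"
      using reals_Archimedean[of "e\<^sup>2 / 8"] e by auto
    have "dist (X i) (X j) < e" if "i \<ge> N" "j \<ge> N" for i j
    proof -
      have *: "J (X i) < m + e\<^sup>2 / 8" if "i \<ge> N" for i
      proof -
        have "1 / real (Suc i) \<le> inverse (real (Suc N))"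
          using that by (simp add: inverse_eq_divide frac_le)
        then show ?thesis using X[of i] N by linarith
      qed
      have "(norm (X i - X j))\<^sup>2 < e\<^sup>2"
        using mid[of "X i" "X j"] *[OF that(1)] *[OF that(2)] m[of "(1/2) *\<^sub>R (X i + X j)"] by linarith
      then show ?thesis using e by (simp add: dist_norm power_less_imp_less_base)
    qed
    then show "\<exists>N. \<forall>i\<ge>N. \<forall>j\<ge>N. dist (X i) (X j) < e" by blast
  qed
  then obtain z where z: "X \<longlonglongrightarrow> z" by (auto simp: Cauchy_convergent_iff convergent_def)
  have "(\<lambda>n. J (X n)) \<longlonglongrightarrow> J z"
    unfolding J_def by (intro tendsto_intros z l.tendsto) simp
  moreover have "(\<lambda>n. m + 1 / real (Suc n)) \<longlonglongrightarrow> m + 0"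
    using LIMSEQ_inverse_real_of_nat by (intro tendsto_add tendsto_const) (simp add: inverse_eq_divide)
  ultimately have "J z \<le> m + 0"
    by (rule LIMSEQ_le) (use X less_imp_le in blast)
  then have min: "J z \<le> J x" for x using m[of x] by linarith
  have "l x = inner x z" for x
  proof -
    define a q where "a = inner x z - l x" and "q = (norm x)\<^sup>2 / 2"
    have q: "q \<ge> 0" by (simp add: q_def)
    have expand: "J (z + t *\<^sub>R x) = J z + t * a + t\<^sup>2 * q" for t
      by (simp add: J_def a_def q_def l.scaleR l.add power_mult_distrib power2_norm_eq_inner
          inner_simps inner_commute algebra_simps power2_eq_square[of t])
    \<comment> \<open>A step against the sign of \<open>a\<close>, too short for the quadratic term to outweigh the linear one, and defined also for \<open>q = 0\<close>.\<close>
    define t where "t = - a / (q + 1)"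
    have a: "a = - t * (q + 1)" using q by (simp add: t_def)
    have "t * a + t\<^sup>2 * q = - t\<^sup>2"
      unfolding a by (simp add: power2_eq_square algebra_simps)
    then have "t = 0" using min[of "z + t *\<^sub>R x"] unfolding expand by simp
    then show ?thesis using a by (simp add: a_def)
  qed
  then show ?thesis by blast
qed

text \<open>Riesz representation of the real part suffices: the imaginary part of a complex linear functional at
  \<open>x\<close> is its real part at \<open>- \<i> x\<close>.\<close>

lemma bounded_clinear_adjoint:
  fixes T :: "'a::{complex_inner, banach} \<Rightarrow> 'a"
  assumes T: "bounded_clinear T"
  shows "\<exists>z. \<forall>x. cinner (T x) y = cinner x z"
proof -
  have lin: "bounded_linear T" and scale: "\<And>c x. T (c *\<^sub>C x) = c *\<^sub>C T x"
    using T by (auto simp: bounded_clinear_def)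
  have "bounded_linear (\<lambda>x. inner (T x) y)"
    using bounded_linear_compose[OF bounded_linear_inner_left lin] .
  from riesz_representation[OF this] obtain z where z: "\<And>x. inner (T x) y = inner x z" by blast
  have Re: "Re (cinner (T x) y) = Re (cinner x z)" for x
    using z[of x] by (simp add: inner_eq_Re_cinner)
  have "cinner (T x) y = cinner x z" for x
    using Re[of x] Re[of "(- \<i>) *\<^sub>C x"] by (simp add: scale cinner_scaleC_left complex_eq_iff)
  then show ?thesis by blast
qed


section \<open>The generator and its adjoint\<close>

text \<open>A vector orthogonal to the domain is orthogonal to all its own mollifications, which converge to it.\<close>

lemma generator_domain_dense:
  fixes S :: "real \<Rightarrow> 'a \<Rightarrow> 'a::{complex_inner, banach}"
  assumes S: "C0_semigroup S" and gen: "generates D A S"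
    and w: "\<And>x. x \<in> D \<Longrightarrow> cinner x w = 0"
  shows "w = 0"
proof -
  have "orbit_integral S h w \<in> D" if h: "h \<ge> 0" for h
  proof -
    have "orbit_integral S h (S s w) = S s (orbit_integral S h w)" if s: "s \<ge> 0" for s
    proof -
      have "S s (orbit_integral S h w) = integral {0..h} (S s \<circ> (\<lambda>t. S t w))"
        unfolding orbit_integral_def
        by (rule integral_linear[OF orbit_integrable[OF S order_refl] C0_semigroup_bounded_linear[OF S s], symmetric])
      also have "\<dots> = integral {0..h} (\<lambda>t. S t (S s w))"
        using S s by (intro integral_cong) (auto simp: C0_semigroup_def, metis add.commute)
      finally show ?thesis by (simp add: orbit_integral_def)
    qed
    then have "\<forall>\<^sub>F s in at_right 0. (orbit_integral S h (S s w) - orbit_integral S h w) /\<^sub>R s =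
        (S s (orbit_integral S h w) - orbit_integral S h w) /\<^sub>R s"
      by (intro eventually_mono[OF eventually_at_right_less]) simp
    from Lim_transform_eventually[OF orbit_integral_difference_quotient[OF S h] this]
    show ?thesis using gen unfolding generates_def by blast
  qed
  then have zero: "\<forall>\<^sub>F h in at_right 0. cinner (orbit_integral S h w /\<^sub>R h) w = 0"
    using w linear_scale[OF bounded_linear.linear[OF bounded_linear_cinner_left[of w]]]
    by (intro eventually_mono[OF eventually_at_right_less]) simp
  have "((\<lambda>h. cinner (orbit_integral S h w /\<^sub>R h) w) \<longlongrightarrow> cinner w w) (at_right 0)"
    by (rule bounded_linear.tendsto[OF bounded_linear_cinner_left orbit_integral_mean[OF S]])
  then have "((\<lambda>h::real. 0) \<longlongrightarrow> cinner w w) (at_right 0)"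
    by (rule Lim_transform_eventually[OF _ zero])
  then have "cinner w w = 0" by (simp add: tendsto_const_iff)
  then show ?thesis using inner_eq_Re_cinner[of w w] by simp
qed

text \<open>The mollifiers are bounded, so they have adjoints. Since \<open>A\<close> followed by a mollifier extends to the
  bounded operator \<open>S h - 1\<close>, the adjoints map into the domain of the adjoint generator. A vector
  orthogonal to that domain is hence annihilated by every mollifier.\<close>

lemma adj_dom_dense:
  fixes S :: "real \<Rightarrow> 'a \<Rightarrow> 'a::{complex_inner, banach}"
  assumes S: "C0_semigroup S" and gen: "generates D A S"
    and x: "\<And>z. z \<in> adj_dom D A \<Longrightarrow> cinner x z = 0"
  shows "x = 0"
proof -
  have zero: "orbit_integral S h x = 0" if h: "h \<ge> 0" for h
  proof (rule cinner_eq_zero_imp)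
    fix y
    have O: "bounded_clinear (orbit_integral S h)" by (rule orbit_integral_bounded_clinear[OF S h])
    then have Olin: "bounded_linear (orbit_integral S h)" by (simp add: bounded_clinear_def)
    have "bounded_clinear (\<lambda>x. S h x - x)"
      using S h bounded_linear_sub[OF C0_semigroup_bounded_linear[OF S h] bounded_linear_ident]
        linear_diff[OF bounded_linear.linear[OF bounded_linear_scaleC]]
      unfolding C0_semigroup_def bounded_clinear_def by metis
    from bounded_clinear_adjoint[OF this] obtain w where w: "\<And>x. cinner (S h x - x) y = cinner x w"
      by blast
    from bounded_clinear_adjoint[OF O] obtain z where z: "\<And>x. cinner (orbit_integral S h x) y = cinner x z"
      by blast
    have "orbit_integral S h (A d) = S h d - d" if d: "d \<in> D" for d
    proof (rule tendsto_unique[OF _ _ orbit_integral_difference_quotient[OF S h]])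
      have "((\<lambda>s. (S s d - d) /\<^sub>R s) \<longlongrightarrow> A d) (at_right 0)"
        using gen d unfolding generates_def by blast
      from bounded_linear.tendsto[OF Olin this]
      show "((\<lambda>s. (orbit_integral S h (S s d) - orbit_integral S h d) /\<^sub>R s) \<longlongrightarrow> orbit_integral S h (A d)) (at_right 0)"
        using bounded_linear.linear[OF Olin] by (simp add: linear_scale linear_diff)
    qed simp
    then have "cinner (A d) z = cinner d w" if "d \<in> D" for d
      using that z[of "A d"] w[of d] by simp
    then have "z \<in> adj_dom D A" unfolding adj_dom_def by blast
    then show "cinner (orbit_integral S h x) y = 0" using x z[of x] by simp
  qed
  have "((\<lambda>h::real. 0) \<longlongrightarrow> x) (at_right 0)"
    using orbit_integral_mean[OF S, of x]
    by (rule Lim_transform_eventually)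
      (rule eventually_mono[OF eventually_at_right_less], simp add: zero)
  then show ?thesis by (simp add: tendsto_const_iff)
qed

text \<open>The adjoint generator is single-valued because the domain of the generator is dense.\<close>

lemma adj_eqI:
  fixes S :: "real \<Rightarrow> 'a \<Rightarrow> 'a::{complex_inner, banach}"
  assumes S: "C0_semigroup S" and gen: "generates D A S"
    and w: "\<And>x. x \<in> D \<Longrightarrow> cinner (A x) z = cinner x w"
  shows "adj D A z = w"
  unfolding adj_def
proof (rule the_equality)
  fix w' assume "\<forall>x\<in>D. cinner (A x) z = cinner x w'"
  then have "cinner x (w' + (- 1) *\<^sub>C w) = 0" if "x \<in> D" for x
    using w that by (simp add: cinner_add_right cinner_scaleC_right)
  from generator_domain_dense[OF S gen this]
  show "w' = w" using scaleC_of_real[of "- 1" w] by simp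
qed (use w in blast)

lemma adj_dom_scaleC:
  fixes S :: "real \<Rightarrow> 'a \<Rightarrow> 'a::{complex_inner, banach}"
  assumes S: "C0_semigroup S" and gen: "generates D A S" and z: "z \<in> adj_dom D A"
  shows "c *\<^sub>C z \<in> adj_dom D A" "adj D A (c *\<^sub>C z) = c *\<^sub>C adj D A z"
proof -
  obtain w where w: "\<And>x. x \<in> D \<Longrightarrow> cinner (A x) z = cinner x w"
    using z unfolding adj_dom_def by blast
  then have "adj D A z = w" by (rule adj_eqI[OF S gen])
  moreover have cw: "cinner (A x) (c *\<^sub>C z) = cinner x (c *\<^sub>C w)" if "x \<in> D" for x
    using w[OF that] by (simp add: cinner_scaleC_right)
  ultimately show "adj D A (c *\<^sub>C z) = c *\<^sub>C adj D A z"
    using adj_eqI[OF S gen cw] by simp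
  show "c *\<^sub>C z \<in> adj_dom D A" using cw unfolding adj_dom_def by blast
qed

section \<open>The extrapolation space\<close>

text \<open>The norm of the dual space is a supremum over the unit ball of the graph norm. A bound for the pairing
  with an arbitrary \<open>z\<close> follows by normalizing \<open>z\<close>, which is possible because the graph norm of the
  adjoint is homogeneous. A functional all of whose pairings vanish has norm \<open>0\<close>.\<close>

lemma extrapolation_functionals:
  fixes S :: "real \<Rightarrow> 'h \<Rightarrow> 'h::{complex_inner, banach}"
    and dual :: "'m::complex_normed_vector \<Rightarrow> 'h \<Rightarrow> complex"
  assumes S: "C0_semigroup S" and gen: "generates D A S"
    and ext: "extrapolation_space D A S dual \<iota> S1"
  shows bounded_linear_dual: "z \<in> adj_dom D A \<Longrightarrow> bounded_linear (\<lambda>\<phi>. dual \<phi> z)"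
    and dual_separates: "(\<And>z. z \<in> adj_dom D A \<Longrightarrow> dual \<phi> z = dual \<psi> z) \<Longrightarrow> \<phi> = \<psi>"
proof -
  let ?V = "adj_dom D A" and ?N = "graph_norm (adj D A)"
  have anti: "\<And>\<phi>. bounded_antilinear_on ?V ?N (dual \<phi>)"
    and add: "\<And>\<phi> \<psi> z. z \<in> ?V \<Longrightarrow> dual (\<phi> + \<psi>) z = dual \<phi> z + dual \<psi> z"
    and scale: "\<And>c \<phi> z. z \<in> ?V \<Longrightarrow> dual (c *\<^sub>C \<phi>) z = c * dual \<phi> z"
    and norm: "\<And>\<phi>. norm \<phi> = (SUP z\<in>{z\<in>?V. ?N z \<le> 1}. cmod (dual \<phi> z))"
    using ext unfolding extrapolation_space_def realizes_dual_def by blast+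
  have zero_in: "0 \<in> ?V"
    unfolding adj_dom_def by (auto intro!: exI[of _ 0] simp: cinner_zero_right)
  have adj0: "adj D A 0 = 0"
    by (rule adj_eqI[OF S gen]) (simp add: cinner_zero_right)
  have norm_le: "norm z \<le> ?N z" for z
    by (simp add: graph_norm_def real_le_rsqrt)
  have anti_scale: "dual \<phi> (c *\<^sub>C z) = cnj c * dual \<phi> z" if "z \<in> ?V" for c \<phi> z
    using anti[of \<phi>] that unfolding bounded_antilinear_on_def by blast
  have upper: "cmod (dual \<phi> z) \<le> norm \<phi>" if "z \<in> ?V" "?N z \<le> 1" for \<phi> z
  proof -
    obtain K where K: "\<And>z. z \<in> ?V \<Longrightarrow> cmod (dual \<phi> z) \<le> K * ?N z"
      using anti[of \<phi>] unfolding bounded_antilinear_on_def by blast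
    have "cmod (dual \<phi> z) \<le> \<bar>K\<bar>" if "z \<in> ?V" "?N z \<le> 1" for z
    proof -
      have "0 \<le> ?N z" using norm_le[of z] norm_ge_zero order_trans by blast
      then have "K * ?N z \<le> \<bar>K\<bar> * 1" using that by (intro mult_mono) auto
      then show ?thesis using K[OF that(1)] by simp
    qed
    then have "bdd_above ((\<lambda>z. cmod (dual \<phi> z)) ` {z\<in>?V. ?N z \<le> 1})"
      by (auto intro!: bdd_aboveI2)
    then show ?thesis unfolding norm[of \<phi>] using that by (intro cSUP_upper) auto
  qed
  show "bounded_linear (\<lambda>\<phi>. dual \<phi> z)" if z: "z \<in> ?V"
  proof (rule bounded_linear_intro[where K = "?N z"])
    fix \<phi> \<psi> r
    show "dual (\<phi> + \<psi>) z = dual \<phi> z + dual \<psi> z" by (rule add[OF z])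
    show "dual (r *\<^sub>R \<phi>) z = r *\<^sub>R dual \<phi> z"
      using scale[OF z, of "complex_of_real r" \<phi>] by (simp add: scaleC_of_real scaleR_conv_of_real)
    show "norm (dual \<phi> z) \<le> norm \<phi> * ?N z"
    proof (cases "?N z = 0")
      case True
      then have "z = 0" using norm_le[of z] by simp
      then have "dual \<phi> z = 0"
        using anti_scale[OF z, of \<phi> 0] scaleC_of_real[of 0 z] by simp
      then show ?thesis using True by simp
    next
      case False
      then have pos: "?N z > 0" using norm_le[of z] norm_ge_zero[of z] by linarith
      define c where "c = complex_of_real (inverse (?N z))"
      have c: "cmod c = inverse (?N z)" using pos by (simp add: c_def norm_inverse)
      have "?N (c *\<^sub>C z) = sqrt ((cmod c)\<^sup>2 * ((norm z)\<^sup>2 + (norm (adj D A z))\<^sup>2))"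
        unfolding graph_norm_def adj_dom_scaleC(2)[OF S gen z]
        by (simp add: norm_scaleC power_mult_distrib distrib_left)
      also have "\<dots> = cmod c * ?N z"
        by (simp add: real_sqrt_mult graph_norm_def)
      finally have "?N (c *\<^sub>C z) \<le> 1" using c pos by simp
      then have "cmod (dual \<phi> (c *\<^sub>C z)) \<le> norm \<phi>"
        by (intro upper adj_dom_scaleC(1)[OF S gen z])
      then show ?thesis unfolding anti_scale[OF z]
        using pos c by (simp add: norm_mult field_simps)
    qed
  qed
  show "\<phi> = \<psi>" if eq: "\<And>z. z \<in> ?V \<Longrightarrow> dual \<phi> z = dual \<psi> z"
  proof -
    have "dual (\<phi> + (- 1) *\<^sub>C \<psi>) z = 0" if "z \<in> ?V" for z
      using eq[OF that] by (simp add: add[OF that] scale[OF that])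
    moreover have "0 \<in> {z\<in>?V. ?N z \<le> 1}" using zero_in adj0 by (simp add: graph_norm_def)
    ultimately have "norm (\<phi> + (- 1) *\<^sub>C \<psi>) = (SUP z\<in>{z\<in>?V. ?N z \<le> 1}. 0)"
      unfolding norm[of "\<phi> + (- 1) *\<^sub>C \<psi>"] by (intro SUP_cong) auto
    also have "\<dots> = 0" using \<open>0 \<in> {z\<in>?V. ?N z \<le> 1}\<close> by (intro cSUP_const) blast
    finally show "\<phi> = \<psi>" using scaleC_of_real[of "- 1" \<psi>] by simp
  qed
qed

text \<open>Injectivity says that \<open>x\<close> is determined by its inner products with the domain of the adjoint, that is,
  that this domain is dense. Without it an element of the pivot space could not be recovered
  from its image.\<close>

lemma pivot_embedding:
  fixes S :: "real \<Rightarrow> 'h \<Rightarrow> 'h::{complex_inner, banach}"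
    and dual :: "'m::complex_normed_vector \<Rightarrow> 'h \<Rightarrow> complex"
  assumes S: "C0_semigroup S" and gen: "generates D A S"
    and ext: "extrapolation_space D A S dual \<iota> S1"
  shows pivot_embedding_linear: "linear \<iota>" and pivot_embedding_inj: "inj \<iota>"
proof -
  have pair: "\<And>x z. z \<in> adj_dom D A \<Longrightarrow> dual (\<iota> x) z = cinner x z"
    using ext unfolding extrapolation_space_def by blast
  note sep = dual_separates[OF S gen ext]
  show "linear \<iota>"
  proof (rule linearI)
    fix x y r
    show "\<iota> (x + y) = \<iota> x + \<iota> y"
      by (rule sep) (simp add: pair cinner_add_left linear_add[OF bounded_linear.linear[OF bounded_linear_dual[OF S gen ext]]])
    show "\<iota> (r *\<^sub>R x) = r *\<^sub>R \<iota> x"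
      by (rule sep) (simp add: pair linear_scale[OF bounded_linear.linear[OF bounded_linear_dual[OF S gen ext]]]
          linear_scale[OF bounded_linear.linear[OF bounded_linear_cinner_left]])
  qed
  then interpret linear \<iota> .
  have "x = 0" if "\<iota> x = 0" for x
  proof (rule adj_dom_dense[OF S gen])
    fix z assume z: "z \<in> adj_dom D A"
    show "cinner x z = 0"
      using pair[OF z, of x] that linear_0[OF bounded_linear.linear[OF bounded_linear_dual[OF S gen ext z]]] by simp
  qed
  then show "inj \<iota>" using linear_injective_0[OF linear_axioms] by blast
qed

section \<open>The control map\<close>

lemma Phi_cong:
  assumes "\<And>s. 0 < s \<Longrightarrow> s < t \<Longrightarrow> v s = w s"
  shows "Phi S1 C t v = Phi S1 C t w"
  unfolding Phi_def by (rule strong_integral_cong) (use assms in auto)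

text \<open>The integrand couples the simple functions that approximate \<open>v\<close> with a time that varies
  continuously. Rounding the time down to a multiple of \<open>2\<^sup>-\<^sup>i\<close> makes the integrand simple; strong
  continuity and local boundedness of the semigroup let both approximations converge together.\<close>

lemma has_strong_integral_Phi:
  fixes S1 :: "real \<Rightarrow> 'm \<Rightarrow> 'm::{complex_normed_vector, banach}"
    and C :: "'u::complex_normed_vector \<Rightarrow> 'm"
  assumes S1: "C0_semigroup S1" and C: "bounded_clinear C" and v: "in_L2 {0<..<t} v"
  shows "has_strong_integral (lebesgue_on {0<..<t}) (\<lambda>\<sigma>. S1 (t - \<sigma>) (C (v \<sigma>))) (Phi S1 C t v)"
proof -
  let ?M = "lebesgue_on {0<..<t}"
  have M: "complete_measure ?M" by (rule complete_measure_lebesgue_on) simp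
  interpret C: bounded_linear C using C by (simp add: bounded_clinear_def)
  obtain KC where KC: "KC \<ge> 0" "\<And>u. norm (C u) \<le> norm u * KC" using C.nonneg_bounded by blast
  obtain K where K: "K \<ge> 0" "\<And>s y. s \<in> {0..t} \<Longrightarrow> norm (S1 s y) \<le> K * norm y"
    using C0_semigroup_locally_bounded[OF S1, of t] by blast
  have mv: "strongly_measurable ?M v" using v by (simp add: in_L2_def)
  then obtain s where s: "\<And>i::nat. simple_function ?M (s i)"
    and lim: "AE x in ?M. (\<lambda>i. s i x) \<longlonglongrightarrow> v x"
    unfolding strongly_measurable_def by blast
  \<comment> \<open>Rounding down keeps \<open>t - q i \<sigma>\<close> in \<open>[0, t]\<close>, where the semigroup is defined and bounded.\<close>
  define q where "q i \<sigma> = real_of_int \<lfloor>2 ^ i * \<sigma>\<rfloor> / 2 ^ i" for i :: nat and \<sigma> :: real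
  have q_le: "q i \<sigma> \<le> \<sigma>" for i \<sigma>
    by (simp add: q_def field_simps)
  have q_ge: "\<sigma> - (1/2) ^ i \<le> q i \<sigma>" for i \<sigma>
  proof -
    have "2 ^ i * \<sigma> - 1 \<le> real_of_int \<lfloor>2 ^ i * \<sigma>\<rfloor>" by linarith
    then have "(2 ^ i * \<sigma> - 1) / 2 ^ i \<le> q i \<sigma>" unfolding q_def by (rule divide_right_mono) simp
    then show ?thesis by (simp add: diff_divide_distrib power_divide)
  qed
  have q_nonneg: "0 \<le> q i \<sigma>" if "0 \<le> \<sigma>" for i \<sigma>
    using that by (simp add: q_def)
  have q_lim: "(\<lambda>i. q i \<sigma>) \<longlonglongrightarrow> \<sigma>" for \<sigma>
  proof (rule tendsto_sandwich)
    show "(\<lambda>i. \<sigma> - (1/2) ^ i) \<longlonglongrightarrow> \<sigma>"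
      using tendsto_diff[OF tendsto_const[of \<sigma>] LIMSEQ_power_zero[of "1/2 :: real"]] by simp
    show "(\<lambda>i. \<sigma>) \<longlonglongrightarrow> \<sigma>" by simp
  qed (use q_le q_ge in auto)
  have q_simple: "simple_function ?M (q i)" for i
  proof (rule simple_function_borel_measurable)
    show "q i \<in> borel_measurable ?M"
    proof -
      have "q i \<in> borel_measurable borel" unfolding q_def by measurable
      then show ?thesis by (intro measurable_restrict_space1 measurable_completion) simp
    qed
    have "q i ` space ?M \<subseteq> (\<lambda>m::int. real_of_int m / 2 ^ i) ` {0..\<lfloor>2 ^ i * t\<rfloor>}"
    proof
      fix y assume "y \<in> q i ` space ?M"
      then obtain \<sigma> where \<sigma>: "0 < \<sigma>" "\<sigma> < t" "y = q i \<sigma>" by auto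
      then have "\<lfloor>2 ^ i * \<sigma>\<rfloor> \<in> {0..\<lfloor>2 ^ i * t\<rfloor>}" by (auto intro: floor_mono)
      then show "y \<in> (\<lambda>m::int. real_of_int m / 2 ^ i) ` {0..\<lfloor>2 ^ i * t\<rfloor>}"
        using \<sigma>(3) unfolding q_def by blast
    qed
    then show "finite (q i ` space ?M)" by (rule finite_subset) simp
  qed
  have "strongly_measurable ?M (\<lambda>\<sigma>. S1 (t - \<sigma>) (C (v \<sigma>)))"
    unfolding strongly_measurable_def
  proof (intro exI conjI allI)
    show "simple_function ?M (\<lambda>\<sigma>. S1 (t - q i \<sigma>) (C (s i \<sigma>)))" for i
      using simple_function_compose2[OF q_simple s, of "\<lambda>a b. S1 (t - a) (C b)"] .
    have space: "AE \<sigma> in ?M. \<sigma> \<in> {0<..<t}" using AE_space[of ?M] by simp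
    from lim space show "AE \<sigma> in ?M. (\<lambda>i. S1 (t - q i \<sigma>) (C (s i \<sigma>))) \<longlonglongrightarrow> S1 (t - \<sigma>) (C (v \<sigma>))"
    proof eventually_elim
      fix \<sigma> assume l: "(\<lambda>i. s i \<sigma>) \<longlonglongrightarrow> v \<sigma>" and \<sigma>: "\<sigma> \<in> {0<..<t}"
      have in_range: "t - q i \<sigma> \<in> {0..t}" for i
        using q_le[of i \<sigma>] q_nonneg[of \<sigma> i] \<sigma> by auto
      have "(\<lambda>i. S1 (t - q i \<sigma>) (C (v \<sigma>))) \<longlonglongrightarrow> S1 (t - \<sigma>) (C (v \<sigma>))"
        using in_range \<sigma>
        by (intro continuous_on_tendsto_compose[OF C0_semigroup_continuous_on[OF S1]]
            tendsto_diff tendsto_const q_lim) auto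
      moreover have "(\<lambda>i. S1 (t - q i \<sigma>) (C (s i \<sigma>) - C (v \<sigma>))) \<longlonglongrightarrow> 0"
      proof (rule Lim_null_comparison)
        show "\<forall>\<^sub>F i in sequentially. norm (S1 (t - q i \<sigma>) (C (s i \<sigma>) - C (v \<sigma>))) \<le> K * norm (C (s i \<sigma>) - C (v \<sigma>))"
          using K(2)[OF in_range] by simp
        have "(\<lambda>i. C (s i \<sigma>) - C (v \<sigma>)) \<longlonglongrightarrow> 0" using C.tendsto[OF l] by (rule LIM_zero)
        then show "(\<lambda>i. K * norm (C (s i \<sigma>) - C (v \<sigma>))) \<longlonglongrightarrow> 0"
          by (intro tendsto_mult_right_zero tendsto_norm_zero)
      qed
      ultimately have "(\<lambda>i. S1 (t - q i \<sigma>) (C (v \<sigma>)) + S1 (t - q i \<sigma>) (C (s i \<sigma>) - C (v \<sigma>)))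
          \<longlonglongrightarrow> S1 (t - \<sigma>) (C (v \<sigma>)) + 0" by (rule tendsto_add)
      moreover have "S1 (t - q i \<sigma>) (C (v \<sigma>)) + S1 (t - q i \<sigma>) (C (s i \<sigma>) - C (v \<sigma>)) =
          S1 (t - q i \<sigma>) (C (s i \<sigma>))" for i
        using in_range[of i] linear_diff[OF bounded_linear.linear[OF C0_semigroup_bounded_linear[OF S1]]] by simp
      ultimately show "(\<lambda>i. S1 (t - q i \<sigma>) (C (s i \<sigma>))) \<longlonglongrightarrow> S1 (t - \<sigma>) (C (v \<sigma>))" by simp
    qed
  qed
  moreover have "(\<integral>\<^sup>+\<sigma>. norm (S1 (t - \<sigma>) (C (v \<sigma>))) \<partial>?M) < \<infinity>"
  proof -
    have [measurable]: "v \<in> borel_measurable ?M" by (rule strongly_measurable_borel[OF M mv])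
    have "norm (S1 (t - \<sigma>) (C (v \<sigma>))) \<le> (K * KC) * norm (v \<sigma>)" if "\<sigma> \<in> {0<..<t}" for \<sigma>
    proof -
      have "norm (S1 (t - \<sigma>) (C (v \<sigma>))) \<le> K * norm (C (v \<sigma>))" using that by (intro K(2)) auto
      also have "\<dots> \<le> K * (norm (v \<sigma>) * KC)" by (intro mult_left_mono KC K)
      finally show ?thesis by (simp add: mult_ac)
    qed
    then have "(\<integral>\<^sup>+\<sigma>. norm (S1 (t - \<sigma>) (C (v \<sigma>))) \<partial>?M) \<le> (\<integral>\<^sup>+\<sigma>. ennreal (K * KC) * norm (v \<sigma>) \<partial>?M)"
      using K KC by (intro nn_integral_mono) (simp flip: ennreal_mult)
    also have "\<dots> = ennreal (K * KC) * (\<integral>\<^sup>+\<sigma>. norm (v \<sigma>) \<partial>?M)"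
      by (rule nn_integral_cmult) measurable
    also have "\<dots> < \<infinity>" using in_L2_imp_L1[OF v] by (simp add: ennreal_mult_less_top)
    finally show ?thesis .
  qed
  ultimately obtain y where "has_strong_integral ?M (\<lambda>\<sigma>. S1 (t - \<sigma>) (C (v \<sigma>))) y"
    using has_strong_integral_exists[OF M] by blast
  then show ?thesis unfolding Phi_def using strong_integral_eq[OF M] by metis
qed

text \<open>Splitting the integral at time \<open>a\<close>, the semigroup carries the first part along for the remaining
  time \<open>b\<close>, and the second part is an integral of the same kind started afresh. Pairing with
  \<open>z\<close> turns all three terms into scalar integrals, where only additivity and translation are needed.\<close>

lemma Phi_append:
  fixes S :: "real \<Rightarrow> 'h \<Rightarrow> 'h::{complex_inner, banach}"
    and dual :: "'m::{complex_normed_vector, banach} \<Rightarrow> 'h \<Rightarrow> complex"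
    and C :: "'u::complex_normed_vector \<Rightarrow> 'm"
  assumes S: "C0_semigroup S" and gen: "generates D A S"
    and ext: "extrapolation_space D A S dual \<iota> S1"
    and C: "bounded_clinear C" and ab: "a \<ge> 0" "b \<ge> 0"
    and v: "in_L2 {0<..<a} v" "in_L2 {0<..<b} (\<lambda>s. v (s + a))"
  shows "Phi S1 C (a + b) v = S1 b (Phi S1 C a v) + Phi S1 C b (\<lambda>s. v (s + a))"
proof (rule dual_separates[OF S gen ext])
  fix z assume z: "z \<in> adj_dom D A"
  define l where "l = (\<lambda>\<phi>. dual \<phi> z)"
  have l: "bounded_linear l" unfolding l_def by (rule bounded_linear_dual[OF S gen ext z])
  have S1: "C0_semigroup S1" using ext by (simp add: extrapolation_space_def)
  have lS: "bounded_linear (\<lambda>\<phi>. l (S1 b \<phi>))"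
    using bounded_linear_compose[OF l C0_semigroup_bounded_linear[OF S1 ab(2)]] .
  note M = complete_measure_lebesgue_on
  have ivl: "{0<..<c::real} \<inter> space lebesgue \<in> sets lebesgue" for c by simp
  define g where "g \<sigma> = l (S1 (a + b - \<sigma>) (C (v \<sigma>)))" for \<sigma>
  have "has_bochner_integral (lebesgue_on {0<..<a + b}) g (l (Phi S1 C (a + b) v))"
    unfolding g_def
    by (intro has_bochner_integral_functional[OF M l] has_strong_integral_Phi[OF S1 C] in_L2_append ab v) simp
  then have whole: "has_bochner_integral lebesgue (\<lambda>\<sigma>. indicator {0<..<a + b} \<sigma> *\<^sub>R g \<sigma>) (l (Phi S1 C (a + b) v))"
    unfolding has_bochner_integral_restrict_space[OF ivl] .
  have "has_bochner_integral (lebesgue_on {0<..<a}) (\<lambda>\<sigma>. l (S1 b (S1 (a - \<sigma>) (C (v \<sigma>))))) (l (S1 b (Phi S1 C a v)))"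
    by (intro has_bochner_integral_functional[OF M lS] has_strong_integral_Phi[OF S1 C] v) simp
  then have "has_bochner_integral lebesgue (\<lambda>\<sigma>. indicator {0<..<a} \<sigma> *\<^sub>R l (S1 b (S1 (a - \<sigma>) (C (v \<sigma>))))) (l (S1 b (Phi S1 C a v)))"
    unfolding has_bochner_integral_restrict_space[OF ivl] .
  moreover have "indicator {0<..<a} \<sigma> *\<^sub>R l (S1 b (S1 (a - \<sigma>) (C (v \<sigma>)))) = indicator {0<..<a} \<sigma> *\<^sub>R g \<sigma>" for \<sigma>
  proof (cases "\<sigma> \<in> {0<..<a}")
    case True
    have "S1 (b + (a - \<sigma>)) x = S1 b (S1 (a - \<sigma>) x)" for x
      using S1 ab True unfolding C0_semigroup_def by simp
    then show ?thesis by (simp add: g_def algebra_simps)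
  qed simp
  ultimately have left: "has_bochner_integral lebesgue (\<lambda>\<sigma>. indicator {0<..<a} \<sigma> *\<^sub>R g \<sigma>) (l (S1 b (Phi S1 C a v)))"
    by simp
  have "has_bochner_integral (lebesgue_on {0<..<b}) (\<lambda>\<sigma>. l (S1 (b - \<sigma>) (C (v (\<sigma> + a))))) (l (Phi S1 C b (\<lambda>s. v (s + a))))"
    by (intro has_bochner_integral_functional[OF M l] has_strong_integral_Phi[OF S1 C] v) simp
  then have "has_bochner_integral lebesgue (\<lambda>\<sigma>. indicator {0<..<b} \<sigma> *\<^sub>R g (\<sigma> + a)) (l (Phi S1 C b (\<lambda>s. v (s + a))))"
    unfolding has_bochner_integral_restrict_space[OF ivl] g_def by simp
  from iffD1[OF has_bochner_integral_lebesgue_real_affine_iff[of 1 _ _ "- a"] this]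
  have right: "has_bochner_integral lebesgue (\<lambda>\<sigma>. indicator {0<..<b} (\<sigma> - a) *\<^sub>R g \<sigma>) (l (Phi S1 C b (\<lambda>s. v (s + a))))"
    by simp
  note both = has_bochner_integral_add[OF left right]
  have "AE \<sigma> in lebesgue. \<sigma> \<noteq> a" using AE_completion[OF AE_lborel_singleton[of a]] .
  then have "AE \<sigma> in lebesgue. indicator {0<..<a} \<sigma> *\<^sub>R g \<sigma> + indicator {0<..<b} (\<sigma> - a) *\<^sub>R g \<sigma> =
      indicator {0<..<a + b} \<sigma> *\<^sub>R g \<sigma>"
    by eventually_elim (use ab in \<open>auto split: split_indicator\<close>)
  then have "has_bochner_integral lebesgue (\<lambda>\<sigma>. indicator {0<..<a + b} \<sigma> *\<^sub>R g \<sigma>)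
      (l (S1 b (Phi S1 C a v)) + l (Phi S1 C b (\<lambda>s. v (s + a))))"
    using both has_bochner_integral_cong_AE[OF borel_measurable_has_bochner_integral[OF both]
        borel_measurable_has_bochner_integral[OF whole]] by blast
  from has_bochner_integral_eq[OF whole this]
  show "dual (Phi S1 C (a + b) v) z = dual (S1 b (Phi S1 C a v) + Phi S1 C b (\<lambda>s. v (s + a))) z"
    using linear_add[OF bounded_linear.linear[OF l]] by (simp add: l_def)
qed

text \<open>With \<open>a = b = 0\<close> the splitting formula reads \<open>\<phi> = \<phi> + \<phi>\<close>.\<close>

lemma Phi_0:
  fixes S :: "real \<Rightarrow> 'h \<Rightarrow> 'h::{complex_inner, banach}"
    and dual :: "'m::{complex_normed_vector, banach} \<Rightarrow> 'h \<Rightarrow> complex"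
    and C :: "'u::complex_normed_vector \<Rightarrow> 'm"
  assumes S: "C0_semigroup S" and gen: "generates D A S"
    and ext: "extrapolation_space D A S dual \<iota> S1" and C: "bounded_clinear C"
  shows "Phi S1 C 0 v = 0"
proof -
  have "in_L2 {} (\<lambda>_::real. 0 :: 'u)" by (auto simp: in_L2_def strongly_measurable_def)
  then have "Phi S1 C (0 + 0) (\<lambda>_. 0) = S1 0 (Phi S1 C 0 (\<lambda>_. 0)) + Phi S1 C 0 (\<lambda>_. 0)"
    by (intro Phi_append[OF S gen ext C]) auto
  moreover have "S1 0 x = x" for x using ext by (simp add: extrapolation_space_def C0_semigroup_def)
  ultimately have "Phi S1 C 0 (\<lambda>_. 0) = 0" by simp
  then show ?thesis using Phi_cong[of 0 v "\<lambda>_. 0" S1 C] by simp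
qed

section \<open>The delayed feedback system\<close>

locale delay_system =
  fixes S :: "real \<Rightarrow> 'h \<Rightarrow> 'h::{complex_inner, banach}"
    and A :: "'h \<Rightarrow> 'h" and D :: "'h set"
    and dual :: "'m::{complex_normed_vector, banach} \<Rightarrow> 'h \<Rightarrow> complex"
    and \<iota> :: "'h \<Rightarrow> 'm" and S1 :: "real \<Rightarrow> 'm \<Rightarrow> 'm"
    and C :: "'u::{complex_inner, banach} \<Rightarrow> 'm"
    and DC :: "'h set" and Cs :: "'h \<Rightarrow> 'u"
    and \<tau> k :: real
    and U0 :: 'h and f :: "real \<Rightarrow> 'u"
  assumes tau: "\<tau> > 0"
    and S: "C0_semigroup S"
    and gen: "generates D A S"
    and ext: "extrapolation_space D A S dual \<iota> S1"
    and C: "bounded_clinear C"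
    and obs: "observation_operator D A dual C DC Cs"
    and H1: "hyp_H1 \<iota> S1 C \<tau>"
    and H2: "hyp_H2 \<iota> S1 C DC Cs \<tau>"
    and H3: "hyp_H3 S DC Cs \<tau>"
    and f: "in_L2 {0<..<\<tau>} f"
begin

abbreviation \<Phi> :: "real \<Rightarrow> (real \<Rightarrow> 'u) \<Rightarrow> 'm" where "\<Phi> \<equiv> Phi S1 C"

lemma S1: "C0_semigroup S1" and S1_\<iota>: "t \<ge> 0 \<Longrightarrow> S1 t (\<iota> x) = \<iota> (S t x)"
  using ext by (auto simp: extrapolation_space_def)

lemma S_add: "S (s + t) x = S s (S t x)" if "s \<ge> 0" "t \<ge> 0"
  using S that by (simp add: C0_semigroup_def)

lemma linear_\<iota>: "linear \<iota>" and inj_\<iota>: "inj \<iota>"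
  using pivot_embedding_linear[OF S gen ext] pivot_embedding_inj[OF S gen ext] by blast+

subsection \<open>One delay interval\<close>

text \<open>The solution on a single delay interval, with time counted from its left end, initial state \<open>x\<close> and
  known delayed observation \<open>w\<close>.\<close>

definition piece :: "'h \<Rightarrow> (real \<Rightarrow> 'u) \<Rightarrow> real \<Rightarrow> 'h" where
  "piece x w t = S t x + k *\<^sub>R inv \<iota> (\<Phi> t w)"

lemma \<iota>_piece:
  assumes "in_L2 {0<..<\<tau>} w" "t \<in> {0..\<tau>}"
  shows "\<iota> (piece x w t) = \<iota> (S t x) + k *\<^sub>R \<Phi> t w"
proof -
  have "\<Phi> t w \<in> range \<iota>" using H1 assms unfolding hyp_H1_def by blast
  then show ?thesis
    by (simp add: piece_def linear_add[OF linear_\<iota>] linear_scale[OF linear_\<iota>] f_inv_into_f)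
qed

lemma piece_0: "piece x w 0 = x"
proof -
  have "inv \<iota> (\<Phi> 0 w) = 0"
    unfolding Phi_0[OF S gen ext C] using inv_f_f[OF inj_\<iota>, of 0] linear_0[OF linear_\<iota>] by simp
  then show ?thesis using S by (simp add: piece_def C0_semigroup_def)
qed

lemma continuous_on_piece:
  assumes "in_L2 {0<..<\<tau>} w"
  shows "continuous_on {0..\<tau>} (piece x w)"
proof -
  have "continuous_on {0..\<tau>} (\<lambda>t. inv \<iota> (\<Phi> t w))"
    using H1 assms unfolding hyp_H1_def by blast
  moreover have "continuous_on {0..\<tau>} (\<lambda>t. S t x)"
    by (rule continuous_on_subset[OF C0_semigroup_continuous_on[OF S]]) auto
  ultimately show ?thesis unfolding piece_def by (intro continuous_intros)
qed

text \<open>The free motion is observable by \<open>H3\<close> and the controlled motion by \<open>H2\<close>; the second assertion is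
  what allows the observation to be fed in on the next interval.\<close>

lemma piece_observable:
  assumes w: "in_L2 {0<..<\<tau>} w"
  shows AE_piece_in_domain: "AE t in lebesgue_on {0<..<\<tau>}. piece x w t \<in> DC"
    and in_L2_observed_piece: "in_L2 {0<..<\<tau>} (\<lambda>t. Cs (piece x w t))"
proof -
  have sub: "\<And>y z. y \<in> DC \<Longrightarrow> z \<in> DC \<Longrightarrow> y + z \<in> DC" "\<And>c z. z \<in> DC \<Longrightarrow> c *\<^sub>C z \<in> DC"
    and lin: "\<And>y z. y \<in> DC \<Longrightarrow> z \<in> DC \<Longrightarrow> Cs (y + z) = Cs y + Cs z"
      "\<And>c z. z \<in> DC \<Longrightarrow> Cs (c *\<^sub>C z) = c *\<^sub>C Cs z"
    using obs unfolding observation_operator_def csubspace_def clinear_on_def by blast+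
  have real: "k *\<^sub>R z = complex_of_real k *\<^sub>C z" for z :: 'h by (simp add: scaleC_of_real)
  have "AE t in lebesgue_on {0<..<\<tau>}. \<Phi> t w \<in> \<iota> ` DC"
    using H2 w unfolding hyp_H2_def by blast
  then have \<Phi>: "AE t in lebesgue_on {0<..<\<tau>}. inv \<iota> (\<Phi> t w) \<in> DC"
    by eventually_elim (auto simp: inv_f_f[OF inj_\<iota>])
  have free: "AE t in lebesgue_on {0<..<\<tau>}. S t x \<in> DC"
    using H3 unfolding hyp_H3_def by blast
  show "AE t in lebesgue_on {0<..<\<tau>}. piece x w t \<in> DC"
    using \<Phi> free by eventually_elim (simp add: piece_def real sub)
  have "in_L2 {0<..<\<tau>} (\<lambda>t. Cs (S t x))" "in_L2 {0<..<\<tau>} (\<lambda>t. Cs (inv \<iota> (\<Phi> t w)))"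
    using H2 H3 w unfolding hyp_H2_def hyp_H3_def by blast+
  then have "in_L2 {0<..<\<tau>} (\<lambda>t. Cs (S t x) + k *\<^sub>R Cs (inv \<iota> (\<Phi> t w)))"
    by (intro in_L2_add in_L2_scaleR) auto
  moreover have "AE t in lebesgue_on {0<..<\<tau>}.
      Cs (S t x) + k *\<^sub>R Cs (inv \<iota> (\<Phi> t w)) = Cs (piece x w t)"
    using \<Phi> free
    by eventually_elim (simp add: piece_def real lin sub, simp add: scaleC_of_real)
  ultimately show "in_L2 {0<..<\<tau>} (\<lambda>t. Cs (piece x w t))" by (rule in_L2_cong_AE)
qed

subsection \<open>Concatenation of the pieces\<close>

text \<open>The \<open>n\<close>-th stage consists of the state at time \<open>n \<tau>\<close> and of the delayed observation on the
  interval that starts there, translated to \<open>(0, \<tau>)\<close>.\<close>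

primrec stage :: "nat \<Rightarrow> 'h \<times> (real \<Rightarrow> 'u)" where
  "stage 0 = (U0, f)"
| "stage (Suc n) = (piece (fst (stage n)) (snd (stage n)) \<tau>,
    \<lambda>t. Cs (piece (fst (stage n)) (snd (stage n)) t))"

definition state :: "nat \<Rightarrow> 'h" where "state n = fst (stage n)"
definition input :: "nat \<Rightarrow> real \<Rightarrow> 'u" where "input n = snd (stage n)"

lemma stage_simps:
  "state 0 = U0" "input 0 = f"
  "state (Suc n) = piece (state n) (input n) \<tau>"
  "input (Suc n) t = Cs (piece (state n) (input n) t)"
  by (simp_all add: state_def input_def)

lemma in_L2_input: "in_L2 {0<..<\<tau>} (input n)"
proof (induction n)
  case 0
  then show ?case by (simp add: stage_simps f)
next
  case (Suc n)
  then show ?case using in_L2_observed_piece[OF Suc] by (simp add: stage_simps)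
qed

definition solution :: "real \<Rightarrow> 'h" where
  "solution t = (let n = nat \<lfloor>t / \<tau>\<rfloor> in piece (state n) (input n) (t - real n * \<tau>))"

text \<open>The function \<open>v\<close> in the integral equation, for the solution just constructed.\<close>

definition delayed_input :: "real \<Rightarrow> 'u" where
  "delayed_input s = (if s < \<tau> then f s else Cs (solution (s - \<tau>)))"

lemma floor_stage: "nat \<lfloor>(real n * \<tau> + r) / \<tau>\<rfloor> = n" if "0 \<le> r" "r < \<tau>"
proof -
  have "(real n * \<tau> + r) / \<tau> = real n + r / \<tau>" using tau by (simp add: field_simps)
  moreover have "0 \<le> r / \<tau>" "r / \<tau> < 1" using that tau by auto
  then have "\<lfloor>real n + r / \<tau>\<rfloor> = int n" by (intro floor_unique) simp_all
  ultimately show ?thesis by simp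
qed

text \<open>At a time \<open>n \<tau>\<close> the solution is defined by the later piece. The earlier piece ends in
  the state in which the later one starts, so the formula extends to both end points.\<close>

lemma solution_on_stage:
  assumes "0 \<le> r" "r \<le> \<tau>"
  shows "solution (real n * \<tau> + r) = piece (state n) (input n) r"
proof (cases "r < \<tau>")
  case True
  then show ?thesis using floor_stage[of r n] assms by (simp add: solution_def)
next
  case False
  then have r: "r = \<tau>" using assms by simp
  have "solution (real (Suc n) * \<tau> + 0) = state (Suc n)"
    using floor_stage[of 0 "Suc n"] tau by (simp add: solution_def piece_0 del: of_nat_Suc)
  then show ?thesis by (simp add: r stage_simps algebra_simps)
qed

lemma delayed_input_on_stage:
  assumes "0 \<le> r" "r < \<tau>"
  shows "delayed_input (real n * \<tau> + r) = input n r"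
proof (cases n)
  case 0
  then show ?thesis using assms by (simp add: delayed_input_def stage_simps)
next
  case (Suc m)
  define a where "a = real m * \<tau> + r"
  have a: "0 \<le> a" "real n * \<tau> + r = a + \<tau>"
    using assms tau by (auto simp: a_def Suc distrib_right)
  have "delayed_input (a + \<tau>) = Cs (solution a)"
    using a(1) by (simp add: delayed_input_def)
  also have "\<dots> = input n r"
    using solution_on_stage[of r m] assms by (simp add: a_def Suc stage_simps)
  finally show ?thesis unfolding a(2) .
qed

lemma in_L2_delayed_input_stage:
  assumes "0 \<le> r" "r \<le> \<tau>"
  shows "in_L2 {0<..<r} (\<lambda>s. delayed_input (s + real n * \<tau>))"
proof (rule in_L2_cong_AE[OF in_L2_subset[OF _ in_L2_input[of n]]])
  show "AE s in lebesgue_on {0<..<r}. input n s = delayed_input (s + real n * \<tau>)"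
    using assms delayed_input_on_stage[of _ n] by (intro AE_I2) (simp add: add.commute)
qed (use assms in auto)

text \<open>The shift by \<open>m \<tau>\<close> is there for the case \<open>m = 1\<close>, in which the function is the observation
  of the solution itself.\<close>

lemma in_L2_delayed_input: "in_L2 {0<..<real n * \<tau>} (\<lambda>s. delayed_input (s + real m * \<tau>))"
proof (induction n)
  case 0
  have "in_L2 {0<..<0} (\<lambda>s. delayed_input (s + real m * \<tau>))"
    using in_L2_delayed_input_stage[of 0 m] tau by simp
  then show ?case by simp
next
  case (Suc n)
  have "in_L2 {0<..<real n * \<tau> + \<tau>} (\<lambda>s. delayed_input (s + real m * \<tau>))"
    using in_L2_delayed_input_stage[of \<tau> "n + m"] tau
    by (intro in_L2_append Suc) (simp_all add: algebra_simps)
  then show ?case by (simp add: algebra_simps)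
qed

text \<open>The integral equation up to time \<open>n \<tau>\<close> is transported by the semigroup over the time \<open>r\<close> and added
  to the integral equation of the piece; the two integrals combine by the splitting formula.\<close>

lemma Duhamel_on_stage:
  assumes state: "\<iota> (state n) = \<iota> (S (real n * \<tau>) U0) + k *\<^sub>R \<Phi> (real n * \<tau>) delayed_input"
    and r: "0 \<le> r" "r \<le> \<tau>"
  shows "\<iota> (piece (state n) (input n) r) =
    \<iota> (S (real n * \<tau> + r) U0) + k *\<^sub>R \<Phi> (real n * \<tau> + r) delayed_input"
proof -
  have n: "0 \<le> real n * \<tau>" using tau by simp
  have lin: "linear (S1 r)" using C0_semigroup_bounded_linear[OF S1 r(1)] by (rule bounded_linear.linear)
  have "\<Phi> (real n * \<tau> + r) delayed_input =
      S1 r (\<Phi> (real n * \<tau>) delayed_input) + \<Phi> r (\<lambda>s. delayed_input (s + real n * \<tau>))"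
    using in_L2_delayed_input[of n 0] in_L2_delayed_input_stage[OF r, of n]
    by (intro Phi_append[OF S gen ext C n r(1)]) simp_all
  moreover have "\<Phi> r (\<lambda>s. delayed_input (s + real n * \<tau>)) = \<Phi> r (input n)"
    using delayed_input_on_stage[of _ n] r by (intro Phi_cong) (simp add: add.commute)
  moreover have "S (real n * \<tau> + r) U0 = S r (S (real n * \<tau>) U0)"
    using S_add[OF r(1) n] by (simp add: add.commute)
  moreover have "\<iota> (piece (state n) (input n) r) = S1 r (\<iota> (state n)) + k *\<^sub>R \<Phi> r (input n)"
    using \<iota>_piece[OF in_L2_input] r by (simp add: S1_\<iota>)
  ultimately show ?thesis
    by (simp add: state linear_add[OF lin] linear_scale[OF lin] S1_\<iota>[OF r(1)] scaleR_add_right)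
qed

lemma Duhamel_state:
  "\<iota> (state n) = \<iota> (S (real n * \<tau>) U0) + k *\<^sub>R \<Phi> (real n * \<tau>) delayed_input"
proof (induction n)
  case 0
  then show ?case using S by (simp add: stage_simps C0_semigroup_def Phi_0[OF S gen ext C])
next
  case (Suc n)
  show ?case using Duhamel_on_stage[OF Suc, of \<tau>] tau by (simp add: stage_simps algebra_simps)
qed

lemma stage_cases:
  assumes "t \<ge> 0"
  obtains n r where "t = real n * \<tau> + r" "0 \<le> r" "r < \<tau>"
proof (rule that)
  let ?n = "nat \<lfloor>t / \<tau>\<rfloor>"
  have n: "real ?n = of_int \<lfloor>t / \<tau>\<rfloor>" using assms tau by simp
  have "real ?n \<le> t / \<tau>" "t / \<tau> < real ?n + 1" unfolding n by linarith+
  then show "0 \<le> t - real ?n * \<tau>" "t - real ?n * \<tau> < \<tau>" using tau by (simp_all add: field_simps)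
  show "t = real ?n * \<tau> + (t - real ?n * \<tau>)" by simp
qed

lemma solution_Duhamel:
  assumes "t \<ge> 0"
  shows "\<iota> (solution t) = \<iota> (S t U0) + k *\<^sub>R \<Phi> t delayed_input"
  using assms
proof (cases rule: stage_cases)
  case (1 n r)
  then show ?thesis using solution_on_stage[of r n] Duhamel_on_stage[OF Duhamel_state, of r n] by simp
qed

lemma continuous_on_solution: "continuous_on {0..} solution"
proof -
  have piecewise: "continuous_on {real n * \<tau>..real n * \<tau> + \<tau>} solution" for n
  proof -
    have "continuous_on {real n * \<tau>..real n * \<tau> + \<tau>} (\<lambda>t. piece (state n) (input n) (t - real n * \<tau>))"
      by (rule continuous_on_compose2[OF continuous_on_piece[OF in_L2_input]])
        (auto intro!: continuous_intros)
    moreover have "solution t = piece (state n) (input n) (t - real n * \<tau>)"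
      if "t \<in> {real n * \<tau>..real n * \<tau> + \<tau>}" for t
      using solution_on_stage[of "t - real n * \<tau>" n] that by simp
    ultimately show ?thesis by (rule continuous_on_eq[OF _ sym])
  qed
  have initial: "continuous_on {0..real n * \<tau>} solution" for n
  proof (induction n)
    case (Suc n)
    have "0 \<le> real n * \<tau>" using tau by simp
    then have "{0..real n * \<tau> + \<tau>} = {0..real n * \<tau>} \<union> {real n * \<tau>..real n * \<tau> + \<tau>}"
      using tau by (intro ivl_disj_un_two_touch(4)[symmetric]) simp_all
    then have "{0..real (Suc n) * \<tau>} = {0..real n * \<tau>} \<union> {real n * \<tau>..real n * \<tau> + \<tau>}"
      by (simp add: algebra_simps)
    then show ?case using continuous_on_closed_Un[OF _ _ Suc piecewise] by simp
  qed simp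
  show ?thesis unfolding continuous_on_eq_continuous_within
  proof
    fix t :: real assume t: "t \<in> {0..}"
    obtain n :: nat where "t / \<tau> < real n" using reals_Archimedean2 by blast
    then have n: "t < real n * \<tau>" using tau by (simp add: field_simps)
    have "at t within {0..} = at t within {0..real n * \<tau>}"
      by (rule at_within_nhd[of _ "{..<real n * \<tau>}"]) (use n in auto)
    then show "continuous (at t within {0..}) solution"
      using initial[of n] t n unfolding continuous_on_eq_continuous_within by auto
  qed
qed

lemma AE_solution_in_domain: "AE t in lebesgue_on {0..}. solution t \<in> DC"
proof -
  \<comment> \<open>Each piece is translated to its place; countably many null sets and the end points are discarded.\<close>
  have "AE t in lebesgue. \<forall>n. t + - (real n * \<tau>) \<in> {0<..<\<tau>} \<longrightarrow>
      piece (state n) (input n) (t + - (real n * \<tau>)) \<in> DC"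
  proof (subst AE_all_countable, rule allI)
    fix n
    have "AE t in lebesgue. t \<in> {0<..<\<tau>} \<longrightarrow> piece (state n) (input n) t \<in> DC"
      using AE_piece_in_domain[OF in_L2_input] by (simp add: AE_restrict_space_iff)
    then show "AE t in lebesgue. t + - (real n * \<tau>) \<in> {0<..<\<tau>} \<longrightarrow>
      piece (state n) (input n) (t + - (real n * \<tau>)) \<in> DC" by (rule AE_lebesgue_shift)
  qed
  moreover have "AE t in lebesgue. \<forall>n. t \<noteq> real n * \<tau>"
    unfolding AE_all_countable using AE_completion[OF AE_lborel_singleton] by blast
  ultimately have "AE t in lebesgue. t \<in> {0..} \<longrightarrow> solution t \<in> DC"
  proof eventually_elim
    case (elim t)
    show ?case
    proof
      assume "t \<in> {0..}"
      then have "t \<ge> 0" by simp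
      then show "solution t \<in> DC"
      proof (cases rule: stage_cases)
        case (1 n r)
        then have "r \<noteq> 0" using elim(2) by auto
        then show ?thesis using 1 elim(1)[rule_format, of n] solution_on_stage[of r n] by simp
      qed
    qed
  qed
  then show ?thesis by (simp add: AE_restrict_space_iff)
qed

lemma in_L2_observed_solution: "in_L2 {0<..<T} (\<lambda>t. Cs (solution t))"
proof -
  obtain n :: nat where "T / \<tau> < real n" using reals_Archimedean2 by blast
  then have n: "T < real n * \<tau>" using tau by (simp add: field_simps)
  have "in_L2 {0<..<T} (\<lambda>s. delayed_input (s + \<tau>))"
    by (rule in_L2_subset[OF _ in_L2_delayed_input[of n 1, simplified]]) (use n in auto)
  moreover have "AE s in lebesgue_on {0<..<T}. delayed_input (s + \<tau>) = Cs (solution s)"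
    by (intro AE_I2) (simp add: delayed_input_def)
  ultimately show ?thesis by (rule in_L2_cong_AE)
qed

lemma mild_solution_solution: "mild_solution S \<iota> S1 C DC Cs k \<tau> U0 f solution"
  unfolding mild_solution_def
  using continuous_on_solution AE_solution_in_domain in_L2_observed_solution solution_Duhamel
  by (auto simp: delayed_input_def[abs_def])

text \<open>Up to time \<open>(n+1) \<tau>\<close> the right-hand side of the integral equation depends on the solution only up to
  time \<open>n \<tau>\<close>.\<close>

lemma mild_solution_unique:
  assumes U: "mild_solution S \<iota> S1 C DC Cs k \<tau> U0 f U"
    and V: "mild_solution S \<iota> S1 C DC Cs k \<tau> U0 f V" and t: "t \<ge> 0"
  shows "V t = U t"
proof -
  have "V t = U t" if "0 \<le> t" "t < real n * \<tau>" for n t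
    using that
  proof (induction n arbitrary: t)
    case (Suc n)
    have "\<Phi> t (\<lambda>s. if s < \<tau> then f s else Cs (V (s - \<tau>))) = \<Phi> t (\<lambda>s. if s < \<tau> then f s else Cs (U (s - \<tau>)))"
      using Suc.prems by (intro Phi_cong) (auto simp: Suc.IH algebra_simps)
    then have "\<iota> (V t) = \<iota> (U t)"
      using U V Suc.prems(1) unfolding mild_solution_def by simp
    then show ?case using inj_\<iota> by (simp add: inj_eq)
  qed simp
  moreover obtain n :: nat where "t / \<tau> < real n" using reals_Archimedean2 by blast
  ultimately show ?thesis using t tau by (simp add: field_simps)
qed

end

theorem proposition4p1:
  fixes S :: "real \<Rightarrow> 'h \<Rightarrow> 'h::{complex_inner, banach}"
    and A :: "'h \<Rightarrow> 'h" and D :: "'h set"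
    and dual :: "'m::{complex_normed_vector, banach} \<Rightarrow> 'h \<Rightarrow> complex"
    and \<iota> :: "'h \<Rightarrow> 'm" and S1 :: "real \<Rightarrow> 'm \<Rightarrow> 'm"
    and C :: "'u::{complex_inner, banach} \<Rightarrow> 'm"
    and DC :: "'h set" and Cs :: "'h \<Rightarrow> 'u"
    and M \<omega> \<tau> k :: real
    and U0 :: 'h and f :: "real \<Rightarrow> 'u"
  assumes "M > 0" "\<omega> > 0" "\<tau> > 0"
    and "C0_semigroup S"
    and "generates D A S"
    and "\<forall>t\<ge>0. onorm (S t) \<le> M * exp (- \<omega> * t)"
    and "extrapolation_space D A S dual \<iota> S1"
    and "bounded_clinear C"
    and "observation_operator D A dual C DC Cs"
    and "hyp_H1 \<iota> S1 C \<tau>"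
    and "hyp_H2 \<iota> S1 C DC Cs \<tau>"
    and "hyp_H3 S DC Cs \<tau>"
    and "in_L2 {0<..<\<tau>} f"
  shows "\<exists>U. mild_solution S \<iota> S1 C DC Cs k \<tau> U0 f U \<and>
    (\<forall>V. mild_solution S \<iota> S1 C DC Cs k \<tau> U0 f V \<longrightarrow> (\<forall>t\<ge>0. V t = U t))"
proof -
  interpret delay_system S A D dual \<iota> S1 C DC Cs \<tau> k U0 f
    by unfold_locales fact+
  show ?thesis
    using mild_solution_solution mild_solution_unique by blast
qed

end
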